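(* Let $r \geq 2$ be an integer and let $\delta > 0$. There exists a constant $C = C(r,\delta)$ such that, for all sufficiently large $n$, there exists an $n$-vertex $(r+1)$-saturated graph $G$ that contains no copy of $T_r(\delta r n)$ and satisfies $e(G) \geq t_r(n) - Cn^{\frac{r+1}{r}}$. Equivalently, in terms of $g_r^*$: there is an absolute constant $c'$ such that for every sufficiently large $D>0$, \[ g_r^*(n,Dn^{\frac{r+1}{r}}) \geq \left(1-\frac{c'\log(Dr)}{D} \right)n \] for all sufficiently large $n$.
   Context: All graphs are finite and simple. For an integer $r\ge 2$, a graph $G$ is $(r+1)$-saturated if it contains no copy of $K_{r+1}$ but adding any edge of its complement creates a copy of $K_{r+1}$. $T_r(k)$ denotes the $r$-partite Turán graph on $k$ vertices (the complete $r$-partite graph whose $r$ classes each have $\lfloor k/r\rfloor$ or $\lceil k/r\rceil$ vertices), and $t_r(n)=e(T_r(n))$. For a graph $G$, $g_r^*(G) = \min\{|T| : T\subseteq V(G),\ G-T \text{ is an } r\text{-partite Turán graph}\}$. For $n,m$, $\mathcal{S}_r(n,m)$ is the set of $(r+1)$-saturated graphs on $n$ vertices with at least $t_r(n)-m$ edges, and $g_r^*(n,m)=\max\{g_r^*(G): G\in\mathcal{S}_r(n,m)\}$. *)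

theory Defs
  imports Complex_Main
begin

datatype 'v ugraph = UGraph (verts: "'v set") (edges: "'v set set")

definition simple_graph :: "'v ugraph \<Rightarrow> bool" where
  "simple_graph G \<longleftrightarrow> finite (verts G) \<and> (\<forall>e\<in>edges G. e \<subseteq> verts G \<and> card e = 2)"

text \<open>A copy is a subgraph, not necessarily induced.\<close>

definition contains_copy :: "'v ugraph \<Rightarrow> 'w ugraph \<Rightarrow> bool" where
  "contains_copy G H \<longleftrightarrow>
     (\<exists>f. inj_on f (verts H) \<and> f ` verts H \<subseteq> verts G \<and> (\<forall>e\<in>edges H. f ` e \<in> edges G))"

definition complete_graph :: "nat \<Rightarrow> nat ugraph" where
  "complete_graph k = UGraph {..<k} {{i, j} | i j. i < k \<and> j < k \<and> i \<noteq> j}"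

definition add_edge :: "'v ugraph \<Rightarrow> 'v set \<Rightarrow> 'v ugraph" where
  "add_edge G e = UGraph (verts G) (insert e (edges G))"

definition delete_verts :: "'v ugraph \<Rightarrow> 'v set \<Rightarrow> 'v ugraph" where
  "delete_verts G T = UGraph (verts G - T) {e \<in> edges G. e \<inter> T = {}}"

text \<open>\<open>saturated s G\<close> refers to the clique on \<open>s\<close> vertices,
  so the \<open>(r+1)\<close>-saturated graphs are those with \<open>s = r + 1\<close>.\<close>

definition saturated :: "nat \<Rightarrow> 'v ugraph \<Rightarrow> bool" where
  "saturated s G \<longleftrightarrow>
     simple_graph G \<and> \<not> contains_copy G (complete_graph s) \<and>
     (\<forall>u\<in>verts G. \<forall>v\<in>verts G. u \<noteq> v \<and> {u, v} \<notin> edges G \<longrightarrow>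
        contains_copy (add_edge G {u, v}) (complete_graph s))"

text \<open>The map \<open>c\<close> assigns to each vertex the index of its class; classes may be empty
  when there are fewer than \<open>r\<close> vertices.\<close>

definition is_turan :: "nat \<Rightarrow> 'v ugraph \<Rightarrow> bool" where
  "is_turan r G \<longleftrightarrow> finite (verts G) \<and>
     (\<exists>c. c ` verts G \<subseteq> {..<r} \<and>
        (\<forall>i<r. int (card {v \<in> verts G. c v = i}) \<in>
           {\<lfloor>real (card (verts G)) / real r\<rfloor>, \<lceil>real (card (verts G)) / real r\<rceil>}) \<and>
        edges G = {{u, v} | u v. u \<in> verts G \<and> v \<in> verts G \<and> c u \<noteq> c v})"

text \<open>The representative of the (unique up to isomorphism) Tur\'an graph \<open>T\<^sub>r(k)\<close>
  whose classes are the residue classes modulo \<open>r\<close>; see \<open>is_turan_turan_graph\<close>.\<close>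

definition turan_graph :: "nat \<Rightarrow> nat \<Rightarrow> nat ugraph" where
  "turan_graph r k = UGraph {..<k} {{i, j} | i j. i < k \<and> j < k \<and> i mod r \<noteq> j mod r}"

definition turan_number :: "nat \<Rightarrow> nat \<Rightarrow> nat" where
  "turan_number r n = card (edges (turan_graph r n))"

text \<open>\<open>turan_number r n\<close> is \<open>t\<^sub>r(n)\<close>; \<open>turan_dist r G\<close>, \<open>saturated_graphs r n m\<close> and
  \<open>max_turan_dist r n m\<close> are usually written \<open>g\<^sub>r\<^sup>*(G)\<close>, \<open>S\<^sub>r(n,m)\<close> and \<open>g\<^sub>r\<^sup>*(n,m)\<close>.\<close>

definition turan_dist :: "nat \<Rightarrow> 'v ugraph \<Rightarrow> nat" where
  "turan_dist r G = Min {card T | T. T \<subseteq> verts G \<and> is_turan r (delete_verts G T)}"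

definition saturated_graphs :: "nat \<Rightarrow> nat \<Rightarrow> real \<Rightarrow> nat ugraph set" where
  "saturated_graphs r n m =
     {G. verts G = {..<n} \<and> saturated (r + 1) G \<and>
         real (card (edges G)) \<ge> real (turan_number r n) - m}"

definition max_turan_dist :: "nat \<Rightarrow> nat \<Rightarrow> real \<Rightarrow> nat" where
  "max_turan_dist r n m = Max (turan_dist r ` saturated_graphs r n m)"

lemma card_residue_class:
  assumes "i < r"
  shows "card {v \<in> {..<k}. v mod r = i} = k div r + (if i < k mod r then 1 else 0)"
proof (induction k)
  case 0
  then show ?case by simp
next
  case (Suc k)
  have "{v \<in> {..<Suc k}. v mod r = i} =
      (if k mod r = i then insert k {v \<in> {..<k}. v mod r = i} else {v \<in> {..<k}. v mod r = i})"
    by (auto simp: less_Suc_eq)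
  then show ?case
    using Suc assms by (auto simp: mod_Suc div_Suc)
qed

lemma is_turan_turan_graph:
  assumes "r > 0"
  shows "is_turan r (turan_graph r k)"
proof -
  have "int (card {v \<in> {..<k}. v mod r = i}) \<in> {\<lfloor>real k / real r\<rfloor>, \<lceil>real k / real r\<rceil>}"
    if "i < r" for i
  proof (cases "i < k mod r")
    case False
    then show ?thesis
      using card_residue_class[OF that] by (simp add: floor_divide_of_nat_eq)
  next
    case True
    have lt: "real (k div r) < real k / real r"
    proof -
      have "k div r * r < k"
        using True by (metis div_mult_mod_eq less_add_same_cancel1 less_zeroE neq0_conv)
      then have "real (k div r) * real r < real k"
        by (metis of_nat_less_iff of_nat_mult)
      then show ?thesis
        using assms by (simp add: pos_less_divide_eq)
    qed
    have "k \<le> (k div r + 1) * r"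
      using assms by (simp add: dividend_less_times_div less_imp_le algebra_simps)
    then have "real k \<le> (real (k div r) + 1) * real r"
      by (metis of_nat_1 of_nat_add of_nat_le_iff of_nat_mult)
    then have "real k / real r \<le> real (k div r) + 1"
      using assms by (simp add: pos_divide_le_eq)
    then have "\<lceil>real k / real r\<rceil> = int (k div r) + 1"
      using lt by (intro ceiling_unique) auto
    then show ?thesis
      using card_residue_class[OF that] True by simp
  qed
  then show ?thesis
    using assms unfolding is_turan_def turan_graph_def
    by (intro conjI exI[of _ "\<lambda>v. v mod r"]) auto
qed

lemma saturated_turan_graph:
  assumes "r > 0"
  shows "saturated (r + 1) (turan_graph r n)"
  unfolding saturated_def
proof (intro conjI ballI impI)
  show "simple_graph (turan_graph r n)"
    by (auto simp: simple_graph_def turan_graph_def card_2_iff)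
  show "\<not> contains_copy (turan_graph r n) (complete_graph (r + 1))"
  proof
    assume "contains_copy (turan_graph r n) (complete_graph (r + 1))"
    then obtain f where "\<forall>e\<in>edges (complete_graph (r + 1)). f ` e \<in> edges (turan_graph r n)"
      unfolding contains_copy_def by blast
    then have f: "{f i, f j} \<in> edges (turan_graph r n)"
      if "i < r + 1" "j < r + 1" "i \<noteq> j" for i j
    proof -
      have "{i, j} \<in> edges (complete_graph (r + 1))"
        unfolding complete_graph_def ugraph.sel using that by blast
      then have "f ` {i, j} \<in> edges (turan_graph r n)"
        using \<open>\<forall>e\<in>edges (complete_graph (r + 1)). f ` e \<in> edges (turan_graph r n)\<close> by blast
      then show ?thesis by simp
    qed
    have "inj_on (\<lambda>i. f i mod r) {..<r + 1}"
    proof (rule inj_onI, rule ccontr)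
      fix i j assume "i \<in> {..<r + 1}" "j \<in> {..<r + 1}" "f i mod r = f j mod r" "i \<noteq> j"
      then show False
        using f[of i j] by (auto simp: turan_graph_def doubleton_eq_iff)
    qed
    moreover have "(\<lambda>i. f i mod r) ` {..<r + 1} \<subseteq> {..<r}"
      using assms by auto
    ultimately have "card {..<r + 1} \<le> card {..<r}"
      by (rule card_inj_on_le) simp
    then show False by simp
  qed
next
  fix u v
  assume uv: "u \<in> verts (turan_graph r n)" "v \<in> verts (turan_graph r n)"
    and h: "u \<noteq> v \<and> {u, v} \<notin> edges (turan_graph r n)"
  then have lt: "u < n" "v < n" and eq: "u mod r = v mod r"
    by (auto simp: turan_graph_def)
  have rn: "r < n"
  proof (rule ccontr)
    assume "\<not> r < n"
    then have "u < r" "v < r" using lt by auto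
    then show False using eq h by simp
  qed
  define f where "f i = (if i = u mod r then u else if i < r then i else v)" for i
  have fmod: "f i mod r = (if i < r then i else u mod r)" if "i < r + 1" for i
    using eq assms by (auto simp: f_def)
  have um: "u mod r < r" using assms by simp
  have fr: "f i = v" if "i = r" for i
    using um that by (auto simp: f_def)
  have fu: "f (u mod r) = u" by (simp add: f_def)
  have ff: "f i \<noteq> f j \<and> {f i, f j} \<in> edges (add_edge (turan_graph r n) {u, v})"
    if "i < r + 1" "j < r + 1" "i < j" for i j
  proof -
    have fn: "f k < n" for k
      using lt rn by (auto simp: f_def)
    show ?thesis
    proof (cases "f i mod r = f j mod r")
      case True
      then have "j = r" "i = u mod r"
        using fmod[of i] fmod[of j] that by (auto split: if_splits)
      then show ?thesis using fu fr h by (auto simp: add_edge_def)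
    next
      case False
      then show ?thesis using fn[of i] fn[of j] by (auto simp: add_edge_def turan_graph_def)
    qed
  qed
  have ff': "f i \<noteq> f j \<and> {f i, f j} \<in> edges (add_edge (turan_graph r n) {u, v})"
    if "i < r + 1" "j < r + 1" "i \<noteq> j" for i j
    using ff[of i j] ff[of j i] that by (metis insert_commute nat_neq_iff)
  have "inj_on f {..<r + 1}"
    using ff' by (meson inj_onI lessThan_iff)
  moreover have "f ` {..<r + 1} \<subseteq> {..<n}"
    using lt rn by (auto simp: f_def)
  moreover have "f ` e \<in> edges (add_edge (turan_graph r n) {u, v})"
    if e: "e \<in> edges (complete_graph (r + 1))" for e
  proof -
    obtain i j where "e = {i, j}" "i < r + 1" "j < r + 1" "i \<noteq> j"
      using e unfolding complete_graph_def by auto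
    then show ?thesis using ff'[of i j] by simp
  qed
  moreover have "verts (complete_graph (r + 1)) = {..<r + 1}"
    and "verts (add_edge (turan_graph r n) {u, v}) = {..<n}"
    by (simp_all add: complete_graph_def add_edge_def turan_graph_def)
  ultimately show "contains_copy (add_edge (turan_graph r n) {u, v}) (complete_graph (r + 1))"
    unfolding contains_copy_def by metis
qed

lemma finite_saturated_graphs: "finite (saturated_graphs r n m)"
proof (rule finite_subset)
  show "saturated_graphs r n m \<subseteq> UGraph {..<n} ` Pow (Pow {..<n})"
  proof
    fix G assume "G \<in> saturated_graphs r n m"
    then have "verts G = {..<n}" "edges G \<subseteq> Pow {..<n}"
      by (auto simp: saturated_graphs_def saturated_def simple_graph_def)
    then show "G \<in> UGraph {..<n} ` Pow (Pow {..<n})"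
      by (cases G) auto
  qed
qed simp

text \<open>The minimum and maximum above range over finite nonempty sets
  in the cases of interest.\<close>

lemma saturated_graphs_nonempty:
  assumes "r > 0" "m \<ge> 0"
  shows "saturated_graphs r n m \<noteq> {}"
proof -
  have "turan_graph r n \<in> saturated_graphs r n m"
    using assms saturated_turan_graph[of r n]
    by (simp add: saturated_graphs_def turan_number_def turan_graph_def)
  then show ?thesis by blast
qed

lemma turan_dist_set:
  assumes "simple_graph G"
  shows "finite {card T | T. T \<subseteq> verts G \<and> is_turan r (delete_verts G T)}"
    and "{card T | T. T \<subseteq> verts G \<and> is_turan r (delete_verts G T)} \<noteq> {}"
proof -
  show "finite {card T | T. T \<subseteq> verts G \<and> is_turan r (delete_verts G T)}"
    using assms by (simp add: simple_graph_def)
  have e: "{e \<in> edges G. e \<inter> verts G = {}} = {}"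
    using assms by (fastforce simp: simple_graph_def Int_absorb2)
  have "is_turan r (delete_verts G (verts G))"
    unfolding is_turan_def delete_verts_def e by simp
  then show "{card T | T. T \<subseteq> verts G \<and> is_turan r (delete_verts G T)} \<noteq> {}"
    by blast
qed

end

(* Start from the Turan graph with classes A, B, V_2, ..., V_{r-1} and choose d random labellings of
   A and B by L = m^(r-1) labels, m about n^(1/r), deleting the edges between equally labelled
   vertices. A union bound over pairs of vertex sets and over sets of labels shows that all large
   S in A and T in B share a label in one of the labellings. To keep the deleted edges out of every
   K_{r+1}-free supergraph, add for each labelling r - 1 sets of m "blockers", one set for each digit
   of the labels in base m, and join a blocker to the vertices of A and B whose label has the given
   digit. The r - 1 blockers of a common label complete any deleted edge to a K_{r+1}. All but one
   of the digits have their blockers inside V_2, ..., V_{r-1}, where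
   each loses only its O(n/r) neighbours in A and B; the total loss is O(d n^(1+1/r)) uniformly in r.
   In a saturated supergraph the classes stay independent up to o(n) vertices, so a complete
   r-partite subgraph must place one class in A and another in B, which forces a class of size
   less than 4n/(dr). *)

theory Submission
  imports Defs "HOL-Library.FuncSet"
begin

section \<open>Random labellings\<close>

text \<open>Markov's inequality by counting: an exceptional \<open>x\<close> has \<open>g x\<close>
  at least \<open>2 * c + 1\<close>, so if half of \<open>F\<close> were exceptional the sum would
  exceed \<open>c * card F\<close>. The conclusion is strict so that two exceptional sets together
  cannot exhaust \<open>F\<close>.\<close>

lemma markov_half:
  fixes g :: "'a \<Rightarrow> nat"
  assumes "finite F" "F \<noteq> {}" "sum g F \<le> c * card F"
  shows "2 * card {x \<in> F. \<not> g x \<le> 2 * c} < card F"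
proof (rule ccontr)
  let ?M = "{x \<in> F. \<not> g x \<le> 2 * c}"
  assume "\<not> 2 * card ?M < card F"
  then have "(2 * c + 1) * card F \<le> (2 * c + 1) * (2 * card ?M)" by (intro mult_le_mono2) auto
  also have "\<dots> = 2 * (card ?M * (2 * c + 1))" by simp
  also have "card ?M * (2 * c + 1) \<le> sum g ?M"
    using sum_bounded_below[of ?M "2 * c + 1" g] by auto
  also have "sum g ?M \<le> sum g F"
    using assms(1) by (intro sum_mono2) auto
  finally have "(2 * c + 1) * card F \<le> 2 * (c * card F)"
    using assms(3) by linarith
  then have "card F = 0" by (simp add: algebra_simps)
  then show False using assms by simp
qed

text \<open>A random labelling agrees at \<open>a\<close> and \<open>b\<close> with probability at
  most 1/L: overwriting the value at \<open>a\<close> of an agreeing \<open>f\<close> by any label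
  is reversible, since \<open>f a\<close> can be read off from \<open>f b\<close>.\<close>

lemma card_agreeing_functions_le:
  assumes "finite V" "a \<in> V" "b \<in> V" "a \<noteq> b"
  shows "L * card {f \<in> V \<rightarrow>\<^sub>E {..<L}. f a = f b} \<le> card (V \<rightarrow>\<^sub>E {..<L::nat})"
proof -
  let ?F = "{f \<in> V \<rightarrow>\<^sub>E {..<L}. f a = f b}"
  have "inj_on (\<lambda>(l, f). f(a := l)) ({..<L} \<times> ?F)"
  proof (rule inj_onI, clarsimp)
    fix l f l' f' assume *: "f(a := l) = f'(a := l')" "f a = f b" "f' a = f' b"
    have "l = l'" "f b = f' b" using fun_cong[OF *(1), of a] fun_cong[OF *(1), of b] assms(4) by auto
    moreover have "f = f'"
    proof
      fix x show "f x = f' x"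
        using fun_cong[OF *(1), of x] \<open>f b = f' b\<close> *(2,3) by (cases "x = a") auto
    qed
    ultimately show "l = l' \<and> f = f'" by simp
  qed
  moreover have "(\<lambda>(l, f). f(a := l)) ` ({..<L} \<times> ?F) \<subseteq> V \<rightarrow>\<^sub>E {..<L}"
    using assms(2) by (auto simp: PiE_iff extensional_def)
  ultimately have "card ({..<L} \<times> ?F) \<le> card (V \<rightarrow>\<^sub>E {..<L})"
    by (rule card_inj_on_le) (simp add: assms(1) finite_PiE)
  then show ?thesis by (simp add: card_cartesian_product)
qed

text \<open>A union bound over the image \<open>K\<close> of \<open>S\<close>, counted by the factor
  \<open>2 ^ L\<close>. With p the size of \<open>K\<close>, a fraction (p/L)^k (1 - p/L)^k of all
  labellings maps \<open>S\<close> into \<open>K\<close> and \<open>T\<close> into its complement,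
  and this is at most 4^(-k).\<close>

lemma card_separating_functions_le:
  assumes "finite V" "S \<subseteq> V" "T \<subseteq> V" "S \<inter> T = {}" "card S = k" "card T = k"
  shows "4 ^ k * card {f \<in> V \<rightarrow>\<^sub>E {..<L}. f ` S \<inter> f ` T = {}} \<le> 2 ^ L * card (V \<rightarrow>\<^sub>E {..<L::nat})"
proof -
  let ?box = "\<lambda>K. PiE V (\<lambda>v. if v \<in> S then K else if v \<in> T then {..<L} - K else {..<L})"
  have fin: "finite S" "finite T" "finite (V - S - T)" using assms(1-3) finite_subset by auto
  have V: "V = S \<union> (T \<union> (V - S - T))" using assms by auto
  have split: "prod g V = prod g S * (prod g T * prod g (V - S - T))" for g :: "'a \<Rightarrow> nat"
  proof -
    have "prod g V = prod g (S \<union> (T \<union> (V - S - T)))" using V by simp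
    also have "\<dots> = prod g S * prod g (T \<union> (V - S - T))"
      using fin assms(4) by (intro prod.union_disjoint) auto
    also have "prod g (T \<union> (V - S - T)) = prod g T * prod g (V - S - T)"
      using fin by (intro prod.union_disjoint) auto
    finally show ?thesis .
  qed
  have box: "4 ^ k * card (?box K) \<le> card (V \<rightarrow>\<^sub>E {..<L})" if K: "K \<subseteq> {..<L}" for K
  proof -
    let ?p = "card K"
    let ?M = "L ^ card (V - S - T)"
    have pL: "?p \<le> L" using card_mono[OF _ K] by simp
    have cd: "card ({..<L} - K) = L - ?p" using K by (simp add: card_Diff_subset finite_subset[OF K])
    have T': "prod (\<lambda>v. card (if v \<in> S then K else if v \<in> T then {..<L} - K else {..<L})) T = (L - ?p) ^ k"
    proof -
      have "prod (\<lambda>v. card (if v \<in> S then K else if v \<in> T then {..<L} - K else {..<L})) T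
          = prod (\<lambda>v. L - ?p) T"
        using assms(4) cd by (intro prod.cong) auto
      then show ?thesis using assms(6) by simp
    qed
    have "card (?box K) = ?p ^ k * ((L - ?p) ^ k * ?M)"
      unfolding card_PiE[OF assms(1)] split T' using assms(5) by simp
    then have "4 ^ k * card (?box K) = (4 * (?p * (L - ?p))) ^ k * ?M"
      by (simp add: power_mult_distrib)
    also have "4 * (?p * (L - ?p)) \<le> L * L"
    proof -
      obtain q where q: "L = ?p + q" using pL le_Suc_ex by blast
      \<comment> \<open>This is (p - q)^2 >= 0, taken over \<open>int\<close> because the difference
        may be negative.\<close>
      have "4 * (int ?p * int q) \<le> (int ?p + int q) * (int ?p + int q)"
        using zero_le_square[of "int ?p - int q"] by (simp add: algebra_simps)
      then have "int (4 * (?p * q)) \<le> int ((?p + q) * (?p + q))" by simp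
      then have "4 * (?p * q) \<le> (?p + q) * (?p + q)" by (simp only: of_nat_le_iff)
      moreover have "L - ?p = q" using q by simp
      ultimately show ?thesis using q by simp
    qed
    then have "(4 * (?p * (L - ?p))) ^ k * ?M \<le> (L * L) ^ k * ?M"
      by (intro mult_le_mono1 power_mono) auto
    also have "(L * L) ^ k * ?M = card (V \<rightarrow>\<^sub>E {..<L})"
      unfolding card_PiE[OF assms(1)] split using assms(5,6) by (simp add: power_mult_distrib)
    finally show ?thesis .
  qed
  have "{f \<in> V \<rightarrow>\<^sub>E {..<L}. f ` S \<inter> f ` T = {}} \<subseteq> (\<Union>K\<in>Pow {..<L}. ?box K)"
  proof
    fix f assume f: "f \<in> {f \<in> V \<rightarrow>\<^sub>E {..<L}. f ` S \<inter> f ` T = {}}"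
    then have "f \<in> ?box (f ` S)" "f ` S \<in> Pow {..<L}"
      using assms(2) by (auto simp: PiE_iff)
    then show "f \<in> (\<Union>K\<in>Pow {..<L}. ?box K)" by blast
  qed
  then have "card {f \<in> V \<rightarrow>\<^sub>E {..<L}. f ` S \<inter> f ` T = {}} \<le> card (\<Union>K\<in>Pow {..<L}. ?box K)"
    using assms(1) by (intro card_mono finite_UN_I finite_PiE) (auto intro: finite_subset)
  also have "\<dots> \<le> (\<Sum>K\<in>Pow {..<L}. card (?box K))" by (rule card_UN_le) simp
  finally have "4 ^ k * card {f \<in> V \<rightarrow>\<^sub>E {..<L}. f ` S \<inter> f ` T = {}}
      \<le> (\<Sum>K\<in>Pow {..<L}. 4 ^ k * card (?box K))"
    by (simp add: sum_distrib_left[symmetric])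
  also have "\<dots> \<le> (\<Sum>K\<in>Pow {..<L}. card (V \<rightarrow>\<^sub>E {..<L}))"
    using box by (intro sum_mono) auto
  finally show ?thesis by (simp add: card_Pow)
qed

lemma sum_card_swap:
  assumes "finite F" "finite P"
  shows "(\<Sum>f\<in>F. card {p \<in> P. R f p}) = (\<Sum>p\<in>P. card {f \<in> F. R f p})"
  using sum_multicount_gen[OF assms, of R "\<lambda>p. card {f \<in> F. R f p}"] by auto

text \<open>For fewer than half of all labellings does the number of agreeing pairs exceed twice its mean;
  the same holds for the number of pairs of \<open>P\<close> with disjoint images.\<close>

lemma exists_separating_labelling:
  fixes A B :: "'a set" and L k :: nat
  assumes "finite A" "finite B" "A \<inter> B = {}" "L > 0"
    and P: "P \<subseteq> {(S, T). S \<subseteq> A \<and> T \<subseteq> B \<and> card S = k \<and> card T = k}"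
  obtains f where "\<forall>v\<in>A \<union> B. f v < L"
    "L * card {(a, b) \<in> A \<times> B. f a = f b} \<le> 2 * (card A * card B)"
    "4 ^ k * card {(S, T) \<in> P. f ` S \<inter> f ` T = {}} \<le> 2 * 2 ^ L * card P"
proof -
  let ?F = "(A \<union> B) \<rightarrow>\<^sub>E {..<L}"
  have fin: "finite ?F" using assms(1,2) by (simp add: finite_PiE)
  have ne: "?F \<noteq> {}" using \<open>L > 0\<close> by (auto simp: PiE_eq_empty_iff)
  have finP: "finite P"
    using P assms(1,2) by (intro finite_subset[of P "Pow A \<times> Pow B"]) auto
  have pairs: "{(a, b) \<in> A \<times> B. f a = f b} = {p \<in> A \<times> B. f (fst p) = f (snd p)}"
    "{(S, T) \<in> P. f ` S \<inter> f ` T = {}} = {p \<in> P. f ` fst p \<inter> f ` snd p = {}}" for f :: "'a \<Rightarrow> nat"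
    by (rule set_eqI, simp add: case_prod_beta mem_Times_iff)+
  have "(\<Sum>f\<in>?F. L * card {(a, b) \<in> A \<times> B. f a = f b})
      = L * (\<Sum>f\<in>?F. card {p \<in> A \<times> B. f (fst p) = f (snd p)})"
    unfolding pairs by (simp add: sum_distrib_left)
  also have "\<dots> = (\<Sum>p\<in>A \<times> B. L * card {f \<in> ?F. f (fst p) = f (snd p)})"
    using fin assms(1,2) by (subst sum_card_swap) (auto simp: sum_distrib_left)
  also have "\<dots> \<le> (\<Sum>p\<in>A \<times> B. card ?F)"
    using assms(1-3) by (intro sum_mono card_agreeing_functions_le) auto
  finally have "(\<Sum>f\<in>?F. L * card {(a, b) \<in> A \<times> B. f a = f b}) \<le> card A * card B * card ?F"
    by (simp add: card_cartesian_product)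
  from markov_half[OF fin ne this]
  have 1: "2 * card {f \<in> ?F. \<not> L * card {(a, b) \<in> A \<times> B. f a = f b} \<le> 2 * (card A * card B)} < card ?F" .
  have "(\<Sum>f\<in>?F. 4 ^ k * card {(S, T) \<in> P. f ` S \<inter> f ` T = {}})
      = 4 ^ k * (\<Sum>f\<in>?F. card {p \<in> P. f ` fst p \<inter> f ` snd p = {}})"
    unfolding pairs by (simp add: sum_distrib_left)
  also have "\<dots> = (\<Sum>p\<in>P. 4 ^ k * card {f \<in> ?F. f ` fst p \<inter> f ` snd p = {}})"
    using fin finP by (subst sum_card_swap) (auto simp: sum_distrib_left)
  also have "\<dots> \<le> (\<Sum>p\<in>P. 2 ^ L * card ?F)"
  proof (intro sum_mono card_separating_functions_le)
    fix p assume "p \<in> P"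
    then have "fst p \<subseteq> A" "snd p \<subseteq> B" "card (fst p) = k" "card (snd p) = k"
      using subsetD[OF P \<open>p \<in> P\<close>] by (simp_all add: case_prod_beta)
    then show "fst p \<subseteq> A \<union> B" "snd p \<subseteq> A \<union> B" "fst p \<inter> snd p = {}" "card (fst p) = k" "card (snd p) = k"
      using assms(3) by auto
  qed (use assms(1,2) in auto)
  finally have "(\<Sum>f\<in>?F. 4 ^ k * card {(S, T) \<in> P. f ` S \<inter> f ` T = {}}) \<le> 2 ^ L * card P * card ?F"
    by (simp add: algebra_simps)
  from markov_half[OF fin ne this]
  have 2: "2 * card {f \<in> ?F. \<not> 4 ^ k * card {(S, T) \<in> P. f ` S \<inter> f ` T = {}} \<le> 2 * (2 ^ L * card P)} < card ?F" .
  let ?F1 = "{f \<in> ?F. \<not> L * card {(a, b) \<in> A \<times> B. f a = f b} \<le> 2 * (card A * card B)}"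
  let ?F2 = "{f \<in> ?F. \<not> 4 ^ k * card {(S, T) \<in> P. f ` S \<inter> f ` T = {}} \<le> 2 * (2 ^ L * card P)}"
  have "card (?F1 \<union> ?F2) < card ?F" using 1 2 card_Un_le[of ?F1 ?F2] by linarith
  then have "\<not> ?F \<subseteq> ?F1 \<union> ?F2"
    using fin card_mono[of "?F1 \<union> ?F2" ?F] by auto
  then obtain f where "f \<in> ?F" "f \<notin> ?F1" "f \<notin> ?F2" by blast
  then show thesis by (intro that[of f]) (auto simp: PiE_iff)
qed

text \<open>The labellings are chosen one after another, each with respect to the pairs
  \<open>(S, T)\<close> that no earlier one has given a common label. A round leaves at most a
  fraction 2 * 2^L / 4^k of these pairs, and \<open>large\<close> says that \<open>d\<close> rounds
  bring the initial number, at most 2^(card A + card B), below one.\<close>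

lemma exists_separating_labellings:
  fixes A B :: "'a set" and L k d :: nat
  assumes "finite A" "finite B" "A \<inter> B = {}" "L > 0"
    and large: "card A + card B + (L + 1) * d < 2 * k * d"
  obtains f where "\<forall>i<d. \<forall>v\<in>A \<union> B. f i v < L"
    "\<forall>i<d. L * card {(a, b) \<in> A \<times> B. f i a = f i b} \<le> 2 * (card A * card B)"
    "\<forall>S T. S \<subseteq> A \<and> T \<subseteq> B \<and> k \<le> card S \<and> k \<le> card T \<longrightarrow> (\<exists>i<d. \<exists>a\<in>S. \<exists>b\<in>T. f i a = f i b)"
proof -
  let ?P = "{(S, T). S \<subseteq> A \<and> T \<subseteq> B \<and> card S = k \<and> card T = k}"
  have finP: "finite ?P"
    using assms(1,2) by (intro finite_subset[of ?P "Pow A \<times> Pow B"]) auto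
  have "\<exists>f. (\<forall>i<e. (\<forall>v\<in>A \<union> B. f i v < L) \<and>
      L * card {(a, b) \<in> A \<times> B. f i a = f i b} \<le> 2 * (card A * card B)) \<and>
      (4 ^ k) ^ e * card {(S, T) \<in> ?P. \<forall>i<e. f i ` S \<inter> f i ` T = {}} \<le> (2 * 2 ^ L) ^ e * card ?P" for e
  proof (induction e)
    case 0
    then show ?case by (auto intro!: card_mono finP)
  next
    case (Suc e)
    then obtain f where f: "\<forall>i<e. (\<forall>v\<in>A \<union> B. f i v < L) \<and>
        L * card {(a, b) \<in> A \<times> B. f i a = f i b} \<le> 2 * (card A * card B)"
      "(4 ^ k) ^ e * card {(S, T) \<in> ?P. \<forall>i<e. f i ` S \<inter> f i ` T = {}} \<le> (2 * 2 ^ L) ^ e * card ?P"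
      by blast
    let ?Q = "{(S, T) \<in> ?P. \<forall>i<e. f i ` S \<inter> f i ` T = {}}"
    have "?Q \<subseteq> ?P" by auto
    from exists_separating_labelling[OF assms(1-4) this]
    obtain g where g: "\<forall>v\<in>A \<union> B. g v < L"
      "L * card {(a, b) \<in> A \<times> B. g a = g b} \<le> 2 * (card A * card B)"
      "4 ^ k * card {(S, T) \<in> ?Q. g ` S \<inter> g ` T = {}} \<le> 2 * 2 ^ L * card ?Q" .
    have eq: "{(S, T) \<in> ?P. \<forall>i<Suc e. (f(e := g)) i ` S \<inter> (f(e := g)) i ` T = {}}
        = {(S, T) \<in> ?Q. g ` S \<inter> g ` T = {}}"
    proof -
      have "(\<forall>i<Suc e. (f(e := g)) i ` S \<inter> (f(e := g)) i ` T = {}) \<longleftrightarrow>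
          (\<forall>i<e. f i ` S \<inter> f i ` T = {}) \<and> g ` S \<inter> g ` T = {}" for S T
        unfolding All_less_Suc by (simp add: conj_commute)
      then show ?thesis by auto
    qed
    have "(4 ^ k) ^ Suc e * card {(S, T) \<in> ?Q. g ` S \<inter> g ` T = {}}
        = (4 ^ k) ^ e * (4 ^ k * card {(S, T) \<in> ?Q. g ` S \<inter> g ` T = {}})" by simp
    also have "\<dots> \<le> (4 ^ k) ^ e * (2 * 2 ^ L * card ?Q)" using g(3) by (rule mult_le_mono2)
    also have "\<dots> = 2 * 2 ^ L * ((4 ^ k) ^ e * card ?Q)" by simp
    also have "\<dots> \<le> 2 * 2 ^ L * ((2 * 2 ^ L) ^ e * card ?P)" using f(2) by (rule mult_le_mono2)
    finally have "(4 ^ k) ^ Suc e * card {(S, T) \<in> ?Q. g ` S \<inter> g ` T = {}} \<le> (2 * 2 ^ L) ^ Suc e * card ?P"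
      by simp
    then show ?case
      unfolding eq[symmetric] using f(1) g(1,2) by (intro exI[of _ "f(e := g)"]) (auto simp: less_Suc_eq)
  qed
  from this[of d] obtain f where f: "\<forall>i<d. (\<forall>v\<in>A \<union> B. f i v < L) \<and>
      L * card {(a, b) \<in> A \<times> B. f i a = f i b} \<le> 2 * (card A * card B)"
    "(4 ^ k) ^ d * card {(S, T) \<in> ?P. \<forall>i<d. f i ` S \<inter> f i ` T = {}} \<le> (2 * 2 ^ L) ^ d * card ?P"
    by blast
  let ?Q = "{(S, T) \<in> ?P. \<forall>i<d. f i ` S \<inter> f i ` T = {}}"
  have "card ?P \<le> card (Pow A \<times> Pow B)"
    using assms(1,2) by (intro card_mono) auto
  also have "\<dots> = 2 ^ (card A + card B)"
    using assms(1,2) by (simp add: card_cartesian_product card_Pow power_add)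
  finally have "(2 * 2 ^ L) ^ d * card ?P \<le> (2 * 2 ^ L) ^ d * 2 ^ (card A + card B)"
    by (rule mult_le_mono2)
  also have "(2 * 2 ^ L) ^ d * 2 ^ (card A + card B) = (2::nat) ^ (card A + card B + (L + 1) * d)"
    by (simp add: power_add power_mult power_mult_distrib)
  also have "\<dots> < 2 ^ (2 * k * d)" using large by simp
  also have "(2::nat) ^ (2 * k * d) = (4 ^ k) ^ d"
    by (simp add: power_mult)
  finally have "(4 ^ k) ^ d * card ?Q < (4 ^ k) ^ d * 1" using f(2) by linarith
  then have "card ?Q < 1" by (rule mult_left_less_imp_less) simp
  then have "card ?Q = 0" by (simp only: less_one)
  moreover have "finite ?Q" using finP by (rule rev_finite_subset) auto
  ultimately have Q: "?Q = {}" by simp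
  show thesis
  proof (rule that)
    show "\<forall>S T. S \<subseteq> A \<and> T \<subseteq> B \<and> k \<le> card S \<and> k \<le> card T \<longrightarrow> (\<exists>i<d. \<exists>a\<in>S. \<exists>b\<in>T. f i a = f i b)"
    proof (intro allI impI)
      fix S T assume ST: "S \<subseteq> A \<and> T \<subseteq> B \<and> k \<le> card S \<and> k \<le> card T"
      \<comment> \<open>Only pairs of size exactly \<open>k\<close> were counted; larger sets are
        reduced to subsets of that size.\<close>
      obtain S' where S': "S' \<subseteq> S" "card S' = k" using ST obtain_subset_with_card_n by metis
      obtain T' where T': "T' \<subseteq> T" "card T' = k" using ST obtain_subset_with_card_n by metis
      have "(S', T') \<notin> ?Q" using Q by blast
      then show "\<exists>i<d. \<exists>a\<in>S. \<exists>b\<in>T. f i a = f i b"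
        using ST S' T' by blast
    qed
  qed (use f(1) in auto)
qed

section \<open>Cliques and saturation\<close>

definition clique_in :: "'v ugraph \<Rightarrow> 'v set \<Rightarrow> bool" where
  "clique_in G K \<longleftrightarrow> K \<subseteq> verts G \<and> (\<forall>u\<in>K. \<forall>v\<in>K. u \<noteq> v \<longrightarrow> {u, v} \<in> edges G)"

lemma contains_complete_graph_iff:
  "contains_copy G (complete_graph s) \<longleftrightarrow> (\<exists>K. clique_in G K \<and> finite K \<and> card K = s)"
proof
  assume "contains_copy G (complete_graph s)"
  then obtain f where f: "inj_on f {..<s}" "f ` {..<s} \<subseteq> verts G"
    "\<forall>e\<in>edges (complete_graph s). f ` e \<in> edges G"
    unfolding contains_copy_def complete_graph_def by auto
  have "{f i, f j} \<in> edges G" if "i < s" "j < s" "i \<noteq> j" for i j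
  proof -
    have "{i, j} \<in> edges (complete_graph s)" using that by (auto simp: complete_graph_def)
    then have "f ` {i, j} \<in> edges G" using f(3) by blast
    then show ?thesis by simp
  qed
  then have "clique_in G (f ` {..<s})" using f(2) by (auto simp: clique_in_def)
  moreover have "card (f ` {..<s}) = s" using f(1) by (simp add: card_image)
  ultimately show "\<exists>K. clique_in G K \<and> finite K \<and> card K = s" by blast
next
  assume "\<exists>K. clique_in G K \<and> finite K \<and> card K = s"
  then obtain K where K: "clique_in G K" "finite K" "card K = s" by blast
  then obtain f where f: "bij_betw f {..<s} K"
    using finite_same_card_bij[of "{..<s}" K] by auto
  have "f ` e \<in> edges G" if e: "e \<in> edges (complete_graph s)" for e
  proof -
    obtain i j where ij: "e = {i, j}" "i < s" "j < s" "i \<noteq> j"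
      using e unfolding complete_graph_def by auto
    then have "f i \<in> K" "f j \<in> K" "f i \<noteq> f j"
      using f by (auto simp: bij_betw_def inj_on_def)
    then show ?thesis using K(1) ij by (simp add: clique_in_def)
  qed
  then show "contains_copy G (complete_graph s)"
    using f K(1) unfolding contains_copy_def
    by (intro exI[of _ f]) (auto simp: complete_graph_def bij_betw_def clique_in_def)
qed

lemma simple_graph_edge_neq: "simple_graph G \<Longrightarrow> {u, v} \<in> edges G \<Longrightarrow> u \<noteq> v"
  by (force simp: simple_graph_def)

lemma simple_graph_edge_verts: "simple_graph G \<Longrightarrow> {u, v} \<in> edges G \<Longrightarrow> u \<in> verts G \<and> v \<in> verts G"
  by (fastforce simp: simple_graph_def)

text \<open>Among the finitely many clique-free edge sets containing that of \<open>G\<close> there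
  is an inclusion-maximal one, and by maximality each further edge creates a clique.\<close>

lemma saturated_extension:
  assumes G: "simple_graph G" "\<not> contains_copy G (complete_graph s)"
  obtains H where "verts H = verts G" "edges G \<subseteq> edges H" "saturated s H"
proof -
  let ?V = "verts G"
  let ?C = "{E. edges G \<subseteq> E \<and> simple_graph (UGraph ?V E) \<and> \<not> contains_copy (UGraph ?V E) (complete_graph s)}"
  have "finite ?C"
  proof (rule finite_subset)
    show "?C \<subseteq> Pow (Pow ?V)" by (auto simp: simple_graph_def)
    show "finite (Pow (Pow ?V))" using G(1) by (simp add: simple_graph_def)
  qed
  moreover have "edges G \<in> ?C" using G by simp
  ultimately obtain E where E: "E \<in> ?C" and max: "\<forall>E'\<in>?C. E \<subseteq> E' \<longrightarrow> E = E'"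
    using finite_has_maximal[of ?C] by blast
  have "contains_copy (add_edge (UGraph ?V E) {u, v}) (complete_graph s)"
    if uv: "u \<in> ?V" "v \<in> ?V" "u \<noteq> v" "{u, v} \<notin> E" for u v
  proof (rule ccontr)
    assume "\<not> ?thesis"
    then have "insert {u, v} E \<in> ?C"
      using E uv by (auto simp: add_edge_def simple_graph_def)
    then have "E = insert {u, v} E" using max by blast
    then show False using uv(4) by blast
  qed
  then have "saturated s (UGraph ?V E)" using E by (auto simp: saturated_def)
  then show thesis using E by (intro that[of "UGraph ?V E"]) auto
qed

text \<open>Together with \<open>u\<close> and \<open>v\<close> the r - 1 vertices of
  \<open>Q\<close> would form a K_{r+1}. Only edges inside \<open>Q\<close> and from
  \<open>Q\<close> to the pair are involved, so a blocked pair stays a non-edge in every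
  K_{r+1}-free supergraph.\<close>

lemma edge_blocked:
  assumes G: "simple_graph G" "\<not> contains_copy G (complete_graph (r + 1))"
    and Q: "clique_in G Q" "finite Q" "card Q + 1 = r"
    and uv: "\<forall>x\<in>Q. {x, u} \<in> edges G \<and> {x, v} \<in> edges G"
  shows "{u, v} \<notin> edges G"
proof
  assume e: "{u, v} \<in> edges G"
  have "u \<noteq> v" "u \<notin> Q" "v \<notin> Q" "u \<in> verts G" "v \<in> verts G"
    using simple_graph_edge_neq[OF G(1)] simple_graph_edge_verts[OF G(1)] e uv by blast+
  then have "clique_in G (insert u (insert v Q))" "card (insert u (insert v Q)) = r + 1"
    using Q uv e by (auto simp: clique_in_def insert_commute)
  then show False using G(2) Q(2) by (metis contains_complete_graph_iff finite_insert)
qed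

text \<open>As the classes are residue classes, the first \<open>n\<close> vertices induce the
  smaller Turan graph, and every other edge has an endpoint among the \<open>q\<close> new
  vertices.\<close>

lemma turan_number_add_le:
  "turan_number r (n + q) \<le> turan_number r n + q * (n + q)"
proof -
  let ?S = "(\<lambda>(u, v). {u, v}) ` ({n..<n + q} \<times> {..<n + q})"
  have "edges (turan_graph r (n + q)) \<subseteq> edges (turan_graph r n) \<union> ?S"
  proof
    fix e assume "e \<in> edges (turan_graph r (n + q))"
    then obtain u v where uv: "e = {u, v}" "u < n + q" "v < n + q" "u mod r \<noteq> v mod r"
      by (auto simp: turan_graph_def)
    consider "u < n" "v < n" | "n \<le> u" | "n \<le> v" by linarith
    then show "e \<in> edges (turan_graph r n) \<union> ?S"
    proof cases
      case 1
      then show ?thesis using uv by (auto simp: turan_graph_def)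
    next
      case 2
      then have "e \<in> ?S" using uv by (intro image_eqI[of _ _ "(u, v)"]) auto
      then show ?thesis by blast
    next
      case 3
      then have "e \<in> ?S" using uv by (intro image_eqI[of _ _ "(v, u)"]) auto
      then show ?thesis by blast
    qed
  qed
  moreover have "finite (edges (turan_graph r n))"
    by (rule finite_subset[of _ "Pow {..<n}"]) (auto simp: turan_graph_def)
  ultimately have "turan_number r (n + q) \<le> card (edges (turan_graph r n) \<union> ?S)"
    unfolding turan_number_def by (intro card_mono) auto
  also have "\<dots> \<le> turan_number r n + card ?S"
    unfolding turan_number_def by (rule card_Un_le)
  also have "card ?S \<le> q * (n + q)"
    using card_image_le[of "{n..<n + q} \<times> {..<n + q}" "\<lambda>(u, v). {u, v}"]
    by (simp add: card_cartesian_product)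
  finally show ?thesis by simp
qed

section \<open>The Turan graph with blocked edges\<close>

text \<open>Vertices below \<open>n0\<close> form the Turan graph, with A and B the residue classes of 0 and 1 modulo
  \<open>r\<close>; \<open>h x l\<close> is the digit of the label \<open>x\<close> belonging to colour \<open>l\<close>. The vertices 0 and 1
  get dummy labels: they keep all their neighbours, which makes the classes independent in every
  saturated supergraph.\<close>

locale blocked_turan =
  fixes r d m n0 L :: nat and f h :: "nat \<Rightarrow> nat \<Rightarrow> nat"
  assumes r: "r \<ge> 2" and m: "m > 0" and d: "d > 0"
    and room: "d * m * r + r \<le> n0"
    and label_less: "\<And>i v. i < d \<Longrightarrow> v < n0 \<Longrightarrow> 2 \<le> v \<Longrightarrow> v mod r < 2 \<Longrightarrow> f i v < L"
    and unlabelled: "\<And>i. f i 0 = L" "\<And>i. f i (Suc 0) = L + 1"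
    and digit_less: "\<And>x l. x < L \<Longrightarrow> h x l < m"
    and digits_inj: "\<And>x y. x < L \<Longrightarrow> y < L \<Longrightarrow> \<forall>l\<in>{2..r}. h x l = h y l \<Longrightarrow> x = y"
begin

definition n :: nat where "n = n0 + d * m"

text \<open>The \<open>d * m\<close> vertices from \<open>n0\<close> on receive the extra colour \<open>r\<close>. The blocker with
  \<open>idx = i * m + c\<close> belongs to the \<open>i\<close>-th labelling and the digit value \<open>c\<close>, at the digit
  given by its colour.\<close>

definition colour :: "nat \<Rightarrow> nat" where
  "colour v = (if v < n0 then v mod r else r)"

definition blocker :: "nat \<Rightarrow> bool" where
  "blocker v \<longleftrightarrow> n0 \<le> v \<or> (2 \<le> v mod r \<and> v < d * m * r)"

definition idx :: "nat \<Rightarrow> nat" where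
  "idx v = (if v < n0 then v div r else v - n0)"

text \<open>Adjacency of a blocker \<open>x\<close> to a non-blocker \<open>v\<close> of another
  colour. The test \<open>< L\<close> shuts out the dummy labels of 0 and 1. Towards colours from 2
  on, blockers of colour below \<open>r\<close> keep their Turan edges, whereas those of colour
  \<open>r\<close> have no neighbours among the non-blockers.\<close>

definition link :: "nat \<Rightarrow> nat \<Rightarrow> bool" where
  "link x v \<longleftrightarrow>
     (if colour v < 2
      then f (idx x div m) v < L \<and> h (f (idx x div m) v) (colour x) = idx x mod m
      else colour x < r)"

text \<open>Blockers of different labellings are never joined, so the blockers in a clique all test
  digits of one and the same labelling.\<close>

definition adj :: "nat \<Rightarrow> nat \<Rightarrow> bool" where
  "adj u v \<longleftrightarrow> colour u \<noteq> colour v \<and>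
     (if blocker u then (if blocker v then idx u div m = idx v div m else link u v)
      else if blocker v then link v u
      else \<not> (colour u < 2 \<and> colour v < 2 \<and> (\<exists>i<d. f i u = f i v)))"

definition G :: "nat ugraph" where
  "G = UGraph {..<n} {{u, v} | u v. u < n \<and> v < n \<and> adj u v}"

lemma adj_commute: "adj u v \<longleftrightarrow> adj v u"
proof -
  have "(\<exists>i<d. f i u = f i v) \<longleftrightarrow> (\<exists>i<d. f i v = f i u)" by metis
  then show ?thesis unfolding adj_def by auto
qed

lemma adj_blockers: "blocker u \<Longrightarrow> blocker v \<Longrightarrow>
    adj u v \<longleftrightarrow> colour u \<noteq> colour v \<and> idx u div m = idx v div m"
  and adj_blocker: "blocker u \<Longrightarrow> \<not> blocker v \<Longrightarrow> adj u v \<longleftrightarrow> colour u \<noteq> colour v \<and> link u v"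
  by (simp_all add: adj_def)

lemma verts_G [simp]: "verts G = {..<n}"
  by (simp add: G_def)

lemma edges_G_iff: "{u, v} \<in> edges G \<longleftrightarrow> u < n \<and> v < n \<and> adj u v"
  unfolding G_def using adj_commute by (auto simp: doubleton_eq_iff)

lemma simple_G: "simple_graph G"
  by (auto simp: simple_graph_def G_def adj_def card_2_iff)

lemma colour_le: "colour v \<le> r"
  using r by (simp add: colour_def less_imp_le)

lemma colour_blocker_ge: "blocker v \<Longrightarrow> 2 \<le> colour v"
  using r by (auto simp: blocker_def colour_def)

lemma idx_div_less:
  assumes "blocker v" "v < n"
  shows "idx v div m < d"
proof -
  have "idx v < d * m"
    using assms r by (auto simp: blocker_def idx_def n_def less_mult_imp_div_less)
  then show ?thesis by (rule less_mult_imp_div_less)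
qed

text \<open>A \<open>K\<^sub>r\<^sub>+\<^sub>1\<close> would use every colour once. Its vertex of colour \<open>r\<close> is only adjacent to
  blockers among the colours \<open>2, \<dots>, r - 1\<close>, and these force equal labels in A and B.\<close>

lemma K_free: "\<not> contains_copy G (complete_graph (r + 1))"
proof
  assume "contains_copy G (complete_graph (r + 1))"
  then obtain K where K: "clique_in G K" "finite K" "card K = r + 1"
    unfolding contains_complete_graph_iff by blast
  have adjK: "adj u v" "u < n" if "u \<in> K" "v \<in> K" "u \<noteq> v" for u v
    using K(1) that edges_G_iff by (auto simp: clique_in_def)
  have "inj_on colour K"
    using adjK(1) by (auto simp: inj_on_def adj_def)
  then have "card (colour ` K) = r + 1" using K(3) by (simp add: card_image)
  moreover have "colour ` K \<subseteq> {..r}" using colour_le by auto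
  ultimately have "colour ` K = {..r}" by (intro card_subset_eq) auto
  then have "\<forall>l\<in>{..r}. \<exists>v\<in>K. colour v = l" by (metis imageE)
  then obtain w where w: "\<And>l. l \<le> r \<Longrightarrow> w l \<in> K \<and> colour (w l) = l"
    by (metis atMost_iff)
  have ne: "w l \<noteq> w l'" if "l \<le> r" "l' \<le> r" "l \<noteq> l'" for l l'
    using w that by metis
  have adjw: "adj (w l) (w l')" if "l \<le> r" "l' \<le> r" "l \<noteq> l'" for l l'
    using adjK(1)[of "w l" "w l'"] w[of l] w[of l'] ne[of l l'] that by blast
  have wn: "w l < n" if "l \<le> r" for l
    using K(1) w that by (auto simp: clique_in_def)
  have Br: "blocker (w r)"
  proof (rule ccontr)
    assume "\<not> blocker (w r)"
    then have "colour (w r) = w r mod r" by (simp add: blocker_def colour_def)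
    then show False using w[of r] r mod_less_divisor[of r "w r"] by linarith
  qed
  have B: "blocker (w l)" if "2 \<le> l" "l \<le> r" for l
  proof (cases "l = r")
    case False
    have "\<not> link (w r) (w l)" using w[of l] w[of r] that by (simp add: link_def)
    then show ?thesis
      using adjw[of r l] False that adj_blocker[OF Br] by blast
  qed (use Br in simp)
  define i where "i = idx (w r) div m"
  have i: "i < d" using idx_div_less[OF Br wn] by (simp add: i_def)
  have idx_w: "idx (w l) div m = i" if "2 \<le> l" "l \<le> r" for l
  proof (cases "l = r")
    case False
    then show ?thesis
      using adjw[of l r] adj_blockers[OF B[of l] Br] that by (simp add: i_def)
  qed (simp add: i_def)
  have nb: "\<not> blocker (w l)" if "l < 2" for l
    using colour_blocker_ge[of "w l"] w[of l] r that by auto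
  have L: "f i (w c) < L \<and> h (f i (w c)) l = idx (w l) mod m" if "c < 2" "2 \<le> l" "l \<le> r" for c l
  proof -
    have "adj (w l) (w c)" using adjw[of l c] that by simp
    then have "link (w l) (w c)" using adj_blocker[OF B[of l] nb[of c]] that by simp
    then show ?thesis
      using w[of l] w[of c] idx_w[of l] that by (simp add: link_def)
  qed
  have "f i (w 0) = f i (w 1)"
    using L[of 0] L[of 1] r by (intro digits_inj) auto
  then show False
    using adjw[of 0 1] nb[of 0] nb[of 1] w[of 0] w[of 1] r i by (auto simp: adj_def)
qed

section \<open>Non-edges forced in every saturated supergraph\<close>

text \<open>The dummy labels \<open>L\<close> and \<open>L + 1\<close> differ from each other and
  from all genuine labels, which lie below \<open>L\<close>.\<close>

lemma unlabelled_not_colliding: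
  assumes "i < d" "x < 2" "x mod r \<noteq> y mod r" "y < n0" "y mod r < 2"
  shows "f i x \<noteq> f i y"
proof (cases "y < 2")
  case True
  then have "y = 0 \<and> x = 1 \<or> y = 1 \<and> x = 0" using assms by (auto simp: less_2_cases_iff)
  then show ?thesis using unlabelled by auto
next
  case False
  then have "f i y < L" using assms by (intro label_less) auto
  then show ?thesis using assms unlabelled by (auto simp: less_2_cases_iff)
qed

text \<open>Each colour from 2 to r - 1 occurs exactly \<open>d * m\<close> times below
  \<open>d * m * r\<close>, and the extra vertices supply \<open>d * m\<close> of colour
  \<open>r\<close>: one blocker for each colour, labelling and digit value.\<close>

lemma exists_blocker:
  assumes "2 \<le> l" "l \<le> r" "i < d" "c < m"
  shows "\<exists>w<n. blocker w \<and> colour w = l \<and> idx w = i * m + c"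
proof -
  have "i * m + c < (i + 1) * m" using assms by simp
  also have "\<dots> \<le> d * m" using assms by (intro mult_le_mono1) simp
  finally have lt: "i * m + c < d * m" .
  show ?thesis
  proof (cases "l = r")
    case True
    then show ?thesis
      using lt by (intro exI[of _ "n0 + (i * m + c)"]) (auto simp: n_def blocker_def colour_def idx_def)
  next
    case False
    let ?w = "(i * m + c) * r + l"
    have l: "l < r" using False assms by simp
    have "?w < (i * m + c + 1) * r" using l by simp
    also have "\<dots> \<le> d * m * r" using lt by (intro mult_le_mono1) simp
    finally have "?w < d * m * r" .
    then show ?thesis
      using l assms room
      by (intro exI[of _ ?w]) (auto simp: n_def blocker_def colour_def idx_def)
  qed
qed

context
  fixes H :: "nat ugraph"
  assumes H: "verts H = {..<n}" "edges G \<subseteq> edges H" "saturated (r + 1) H"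
begin

lemma simple_H: "simple_graph H" and K_free_H: "\<not> contains_copy H (complete_graph (r + 1))"
  using H(3) by (auto simp: saturated_def)

lemma adj_H: "u < n \<Longrightarrow> v < n \<Longrightarrow> adj u v \<Longrightarrow> {u, v} \<in> edges H"
  using H(2) edges_G_iff by blast

text \<open>Applies \<open>edge_blocked\<close> to one vertex \<open>w l\<close> of each colour in
  \<open>I\<close>; distinct colours make \<open>w\<close> injective. The set \<open>I\<close> will
  be the colours 2 to \<open>r\<close> for a colliding pair, and all colours below \<open>r\<close>
  but one for a pair inside a class.\<close>

lemma blocked_by_transversal:
  assumes "card I + 1 = r" "finite I" "\<And>l. l \<in> I \<Longrightarrow> w l < n \<and> colour (w l) = l"
    "\<And>l l'. l \<in> I \<Longrightarrow> l' \<in> I \<Longrightarrow> l \<noteq> l' \<Longrightarrow> adj (w l) (w l')"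
    "\<And>l. l \<in> I \<Longrightarrow> adj (w l) u \<and> adj (w l) v" "u < n" "v < n"
  shows "{u, v} \<notin> edges H"
proof (rule edge_blocked[OF simple_H K_free_H])
  have "inj_on w I" using assms(3) by (intro inj_on_inverseI[of _ colour]) blast
  then show "card (w ` I) + 1 = r" using assms(1) by (simp add: card_image)
  show "clique_in H (w ` I)" 
    unfolding clique_in_def
  proof (intro conjI ballI impI)
    show "w ` I \<subseteq> verts H" using assms(3) H(1) by auto
    fix x y assume "x \<in> w ` I" "y \<in> w ` I" "x \<noteq> y"
    then obtain l l' where l: "x = w l" "y = w l'" "l \<in> I" "l' \<in> I" "l \<noteq> l'" by blast
    then show "{x, y} \<in> edges H" using adj_H[of "w l" "w l'"] assms(3,4) by simp
  qed
  show "\<forall>x\<in>w ` I. {x, u} \<in> edges H \<and> {x, v} \<in> edges H" using assms adj_H by auto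
qed (use assms in simp)

text \<open>The blockers of labelling \<open>i\<close> that carry the digits of the common label,
  one in each colour from 2 to \<open>r\<close>, form a clique and are all joined to both
  \<open>a\<close> and \<open>b\<close>.\<close>

lemma colliding_pair_blocked:
  assumes "a < n0" "b < n0" "a mod r = 0" "b mod r = 1" "2 \<le> a" "2 \<le> b" "i < d" "f i a = f i b"
  shows "{a, b} \<notin> edges H"
proof -
  have lab: "f i a < L" using assms r by (intro label_less) auto
  have "\<forall>l\<in>{2..r}. \<exists>w<n. blocker w \<and> colour w = l \<and> idx w = i * m + h (f i a) l"
    using exists_blocker assms(7) digit_less[OF lab] by auto
  then obtain w where w: "\<And>l. l \<in> {2..r} \<Longrightarrow> w l < n \<and> blocker (w l) \<and> colour (w l) = l \<and> idx (w l) = i * m + h (f i a) l"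
    by metis
  have ab: "colour a = 0" "colour b = 1" "\<not> blocker a" "\<not> blocker b"
    using assms r by (auto simp: colour_def blocker_def)
  show ?thesis
  proof (rule blocked_by_transversal[of "{2..r}" w])
    show "card {2..r} + 1 = r" using r by simp
    show "a < n" "b < n" using assms by (auto simp: n_def)
    have idx: "idx (w l) div m = i \<and> idx (w l) mod m = h (f i a) l" if "l \<in> {2..r}" for l
      using w[OF that] digit_less[OF lab, of l] by simp
    show "adj (w l) (w l')" if "l \<in> {2..r}" "l' \<in> {2..r}" "l \<noteq> l'" for l l'
      using w[OF that(1)] w[OF that(2)] idx[OF that(1)] idx[OF that(2)] that(3) by (simp add: adj_def)
    show "adj (w l) a \<and> adj (w l) b" if "l \<in> {2..r}" for l
      using w[OF that] idx[OF that] ab lab assms(8) that by (auto simp: adj_def link_def)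
  qed (use w in auto)
qed

text \<open>Every class contains a non-blocker joined to all non-blockers of the other classes; the
  r - 1 such vertices outside the class of \<open>u\<close> and \<open>v\<close> block the
  pair.\<close>

lemma colour_class_independent:
  assumes "u < n0" "v < n0" "u mod r = v mod r" "\<not> blocker u" "\<not> blocker v"
  shows "{u, v} \<notin> edges H"
proof -
  \<comment> \<open>The vertices 0 and 1 are safe by their dummy labels; for \<open>l\<close> at
    least 2 the first vertex of the class that is not a blocker is taken, which \<open>room\<close>
    keeps below \<open>n0\<close>.\<close>
  define w where "w l = (if l < 2 then l else d * m * r + l)" for l
  have w: "w l < n0" "w l mod r = l" "\<not> blocker (w l)" if "l < r" for l
    using that room r by (auto simp: w_def blocker_def)
  have adjw: "adj (w l) y" if "l < r" "y < n0" "\<not> blocker y" "y mod r \<noteq> l" for l y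
  proof -
    have "f i (w l) \<noteq> f i y" if "l < 2" "y mod r < 2" "i < d" for i
      using unlabelled_not_colliding[of i l y] that w(2)[of l] \<open>l < r\<close> \<open>y < n0\<close> \<open>y mod r \<noteq> l\<close> by (simp add: w_def)
    then show ?thesis using w[OF that(1)] that unfolding adj_def by (auto simp: colour_def)
  qed
  show ?thesis
  proof (rule blocked_by_transversal[of "{..<r} - {u mod r}" w])
    show "card ({..<r} - {u mod r}) + 1 = r" using r by (simp add: card_Diff_singleton)
    show "w l < n \<and> colour (w l) = l" if "l \<in> {..<r} - {u mod r}" for l
      using w[of l] that by (simp add: n_def colour_def)
    show "adj (w l) (w l')" if "l \<in> {..<r} - {u mod r}" "l' \<in> {..<r} - {u mod r}" "l \<noteq> l'" for l l'
      using adjw[of l "w l'"] w[of l'] that by simp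
    show "adj (w l) u \<and> adj (w l) v" if "l \<in> {..<r} - {u mod r}" for l
      using adjw[of l u] adjw[of l v] assms that by simp
  qed (use assms in \<open>simp_all add: n_def\<close>)
qed

end

section \<open>Counting the lost edges\<close>

definition A where "A = {v. v < n0 \<and> v mod r = 0 \<and> 2 \<le> v}"
definition B where "B = {v. v < n0 \<and> v mod r = 1 \<and> 2 \<le> v}"

lemma finite_A: "finite A" and finite_B: "finite B"
  by (simp_all add: A_def B_def)

lemma colliding_mem:
  assumes "u < n0" "v < n0" "u mod r = 0" "v mod r = 1" "i < d" "f i u = f i v"
  shows "u \<in> A" "v \<in> B"
  using unlabelled_not_colliding[of i u v] unlabelled_not_colliding[of i v u] assms
  by (auto simp: A_def B_def not_less[symmetric])

text \<open>A blocker below \<open>n0\<close> has a colour below \<open>r\<close>, so apart from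
  edges to other blockers it loses only edges to the classes of residue 0 and 1. These have size
  about n/r, which is what keeps the total loss uniform in \<open>r\<close>.\<close>

lemma missing_turan_edge:
  assumes "u < n0" "v < n0" "u mod r \<noteq> v mod r" "\<not> adj u v"
  shows "(\<exists>i<d. \<exists>a\<in>A. \<exists>b\<in>B. {u, v} = {a, b} \<and> f i a = f i b) \<or>
    (\<exists>x y. {u, v} = {x, y} \<and> x < d * m * r \<and> (y < d * m * r \<or> y < n0 \<and> y mod r < 2))"
proof -
  have col: "colour u = u mod r" "colour v = v mod r" "u mod r < r" "v mod r < r"
    using assms r by (auto simp: colour_def)
  have small: "x < d * m * r" if "blocker x" "x < n0" for x
    using that by (auto simp: blocker_def)
  consider "blocker u" "blocker v" | "blocker u" "\<not> blocker v" | "\<not> blocker u" "blocker v"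
    | "\<not> blocker u" "\<not> blocker v" by blast
  then show ?thesis
  proof cases
    case 1
    then show ?thesis using small assms by blast
  next
    case 2
    then have "v mod r < 2" using adj_blocker[OF 2] assms col by (auto simp: link_def split: if_splits)
    then show ?thesis using small[OF 2(1)] assms by blast
  next
    case 3
    then have "u mod r < 2"
      using adj_blocker[OF 3(2,1)] assms col adj_commute by (auto simp: link_def split: if_splits)
    then show ?thesis using small[OF 3(2)] assms by (metis insert_commute)
  next
    case 4
    then have "u mod r < 2 \<and> v mod r < 2 \<and> (\<exists>i<d. f i u = f i v)"
      using assms(3,4) col(1,2) unfolding adj_def by simp
    then obtain i where i: "u mod r < 2" "v mod r < 2" "i < d" "f i u = f i v" by blast
    have "u mod r = 0 \<and> v mod r = 1 \<or> v mod r = 0 \<and> u mod r = 1"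
      using assms(3) i(1,2) by (cases "u mod r = 0"; cases "v mod r = 0") simp_all
    then have "\<exists>a\<in>A. \<exists>b\<in>B. {u, v} = {a, b} \<and> f i a = f i b"
    proof (elim disjE conjE)
      assume "u mod r = 0" "v mod r = 1"
      then show ?thesis
        using colliding_mem[OF assms(1,2) _ _ i(3,4)] i(4) by (intro bexI[of _ u] bexI[of _ v]) auto
    next
      assume "v mod r = 0" "u mod r = 1"
      then show ?thesis
        using colliding_mem[OF assms(2,1) _ _ i(3) i(4)[symmetric]] i(4)
        by (intro bexI[of _ v] bexI[of _ u]) auto
    qed
    then show ?thesis using i(3) by (intro disjI1 exI[of _ i] conjI)
  qed
qed

text \<open>The error terms bound the collisions between \<open>A\<close> and \<open>B\<close>, the
  pairs with a vertex below \<open>d * m * r\<close> that \<open>missing_turan_edge\<close> allows,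
  and, by \<open>turan_number_add_le\<close>, the Turan edges at the \<open>d * m\<close> extra
  vertices.\<close>

lemma turan_number_le_card_edges:
  assumes coll: "\<And>i. i < d \<Longrightarrow> card {(a, b) \<in> A \<times> B. f i a = f i b} \<le> q"
  shows "turan_number r n \<le> card (edges G) + d * q
    + d * m * r * (d * m * r + 2 * (n0 div r + 1)) + d * m * n"
proof -
  let ?pr = "\<lambda>(u, v). {u, v} :: nat set"
  let ?C = "\<lambda>i. {(a, b) \<in> A \<times> B. f i a = f i b}"
  let ?S = "\<Union>i<d. ?pr ` ?C i"
  let ?R = "{..<d * m * r} \<union> ({v \<in> {..<n0}. v mod r = 0} \<union> {v \<in> {..<n0}. v mod r = 1})"
  let ?T = "?pr ` ({..<d * m * r} \<times> ?R)"
  have "edges (turan_graph r n0) \<subseteq> edges G \<union> (?S \<union> ?T)"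
  proof
    fix e assume "e \<in> edges (turan_graph r n0)"
    then obtain u v where uv: "e = {u, v}" "u < n0" "v < n0" "u mod r \<noteq> v mod r"
      by (auto simp: turan_graph_def)
    show "e \<in> edges G \<union> (?S \<union> ?T)"
    proof (cases "adj u v")
      case True
      then have "e \<in> edges G" using uv edges_G_iff by (simp add: n_def)
      then show ?thesis by blast
    next
      case False
      from missing_turan_edge[OF uv(2-4) False] consider
        i a b where "i < d" "a \<in> A" "b \<in> B" "e = {a, b}" "f i a = f i b"
        | x y where "e = {x, y}" "x < d * m * r" "y < d * m * r \<or> y < n0 \<and> y mod r < 2"
        unfolding uv(1) by blast
      then show ?thesis
      proof cases
        case 1
        then have "e \<in> ?pr ` ?C i" by (intro image_eqI[of _ _ "(a, b)"]) auto
        then show ?thesis using 1(1) by blast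
      next
        case 2
        then have "y \<in> ?R" by (auto simp: less_2_cases_iff)
        then have "e \<in> ?T" using 2 by (intro image_eqI[of _ _ "(x, y)"]) auto
        then show ?thesis by blast
      qed
    qed
  qed
  moreover have "finite (edges G)"
    by (rule finite_subset[of _ "Pow {..<n}"]) (auto simp: G_def)
  moreover have finC: "finite (?C i)" for i
    using finite_A finite_B by (intro finite_subset[of "?C i" "A \<times> B"]) auto
  ultimately have "turan_number r n0 \<le> card (edges G \<union> (?S \<union> ?T))"
    unfolding turan_number_def by (intro card_mono) auto
  also have "\<dots> \<le> card (edges G) + (card ?S + card ?T)"
    using card_Un_le[of "edges G" "?S \<union> ?T"] card_Un_le[of ?S ?T] by linarith
  also have "card ?S \<le> d * q"
  proof -
    have "card ?S \<le> (\<Sum>i<d. card (?pr ` ?C i))" by (rule card_UN_le) simp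
    also have "\<dots> \<le> (\<Sum>i<d. q)"
    proof (rule sum_mono)
      fix i assume "i \<in> {..<d}"
      then show "card (?pr ` ?C i) \<le> q"
        using card_image_le[OF finC, of ?pr i] coll[of i] by simp
    qed
    finally show ?thesis by simp
  qed
  also have "card ?T \<le> d * m * r * (d * m * r + 2 * (n0 div r + 1))"
  proof -
    have "card ?R \<le> d * m * r + (card {v \<in> {..<n0}. v mod r = 0} + card {v \<in> {..<n0}. v mod r = 1})"
      using card_Un_le[of "{..<d * m * r}" "{v \<in> {..<n0}. v mod r = 0} \<union> {v \<in> {..<n0}. v mod r = 1}"]
        card_Un_le[of "{v \<in> {..<n0}. v mod r = 0}" "{v \<in> {..<n0}. v mod r = 1}"] by simp
    also have "\<dots> \<le> d * m * r + 2 * (n0 div r + 1)"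
      using card_residue_class[of 0 r n0] card_residue_class[of 1 r n0] r by simp
    finally have R: "card ?R \<le> d * m * r + 2 * (n0 div r + 1)" .
    have "card ?T \<le> card ({..<d * m * r} \<times> ?R)" by (intro card_image_le) auto
    also have "\<dots> = d * m * r * card ?R" by (simp add: card_cartesian_product)
    also have "\<dots> \<le> d * m * r * (d * m * r + 2 * (n0 div r + 1))" using R by (rule mult_le_mono2)
    finally show ?thesis .
  qed
  finally show ?thesis
    using turan_number_add_le[of r n0 "d * m"] by (simp add: n_def)
qed

section \<open>Complete multipartite subgraphs of saturated supergraphs\<close>

text \<open>Suppose all \<open>r\<close> classes were large. Outside the exceptional set
  \<open>Z\<close> each still has \<open>k\<close> vertices, and equal residues force equal classes
  because residue classes are independent there. So classes and residues correspond one to one, two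
  classes lie in \<open>A\<close> and \<open>B\<close>, and \<open>sep\<close> yields a colliding
  pair between them, which is not an edge of \<open>H\<close>.\<close>

lemma small_class:
  fixes H :: "nat ugraph"
  assumes H: "verts H = {..<n}" "edges G \<subseteq> edges H" "saturated (r + 1) H"
    and sep: "\<And>S T. S \<subseteq> A \<Longrightarrow> T \<subseteq> B \<Longrightarrow> k \<le> card S \<Longrightarrow> k \<le> card T \<Longrightarrow>
      \<exists>i<d. \<exists>a\<in>S. \<exists>b\<in>T. f i a = f i b"
    and U: "U \<subseteq> {..<n}" "\<And>u v. u \<in> U \<Longrightarrow> v \<in> U \<Longrightarrow> c u \<noteq> c v \<Longrightarrow> {u, v} \<in> edges H"
    and k: "k > 0"
  shows "\<exists>i<r. card {v \<in> U. c v = i} < k + (d * m * r + d * m + 2)"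
proof (rule ccontr)
  assume "\<not> ?thesis"
  then have big: "k + (d * m * r + d * m + 2) \<le> card {v \<in> U. c v = i}" if "i < r" for i
    using that by (meson not_less)
  \<comment> \<open>\<open>Z\<close> contains all blockers and the vertices 0 and 1; its size is at
    most the term added to \<open>k\<close>.\<close>
  define Z where "Z = {..<d * m * r} \<union> ({n0..<n} \<union> {0, 1})"
  have finU: "finite U" using U(1) finite_subset by auto
  have "card Z \<le> d * m * r + d * m + 2"
    using card_Un_le[of "{..<d * m * r}" "{n0..<n} \<union> {0, 1}"] card_Un_le[of "{n0..<n}" "{0, 1}"]
    by (simp add: Z_def n_def)
  then have bigW: "k \<le> card ({v \<in> U. c v = i} - Z)" if "i < r" for i
    using big[OF that] diff_card_le_card_Diff[of Z "{v \<in> U. c v = i}"] by (simp add: Z_def)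
  then have "\<exists>v. v \<in> {v \<in> U. c v = i} - Z" if "i < r" for i
    using k that by (metis card.empty ex_in_conv not_le)
  then obtain p where p: "\<And>i. i < r \<Longrightarrow> p i \<in> {v \<in> U. c v = i} - Z" by metis
  have out: "v < n0 \<and> \<not> blocker v \<and> 2 \<le> v" if "v \<in> U - Z" for v
    using that U(1) by (auto simp: Z_def blocker_def)
  have same: "c u = c v" if "u \<in> U - Z" "v \<in> U - Z" "u mod r = v mod r" for u v
    using colour_class_independent[OF H, of u v] out[OF that(1)] out[OF that(2)] that U(2) by blast
  have "inj_on (\<lambda>i. p i mod r) {..<r}"
  proof (rule inj_onI)
    fix i j assume "i \<in> {..<r}" "j \<in> {..<r}" "p i mod r = p j mod r"
    then show "i = j" using same[of "p i" "p j"] p[of i] p[of j] by simp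
  qed
  then have "(\<lambda>i. p i mod r) ` {..<r} = {..<r}"
    using r by (intro endo_inj_surj) auto
  then have "l \<in> (\<lambda>i. p i mod r) ` {..<r}" if "l < r" for l using that by simp
  then have "\<forall>l. \<exists>i. l < r \<longrightarrow> i < r \<and> p i mod r = l" by blast
  \<comment> \<open>\<open>g l\<close> is the class whose vertices outside \<open>Z\<close> have
    residue \<open>l\<close>. It exists because \<open>r\<close> classes with pairwise different
    residues use up every residue.\<close>
  then obtain g where g: "\<And>l. l < r \<Longrightarrow> g l < r \<and> p (g l) mod r = l" by metis
  have class_colour: "v mod r = l" if "l < r" "v \<in> {v \<in> U. c v = g l} - Z" for l v
  proof -
    have vr: "v mod r < r" using r by simp
    have v: "v \<in> U - Z" "c v = g l" using that(2) by auto
    have pU: "p (g (v mod r)) \<in> U - Z" "c (p (g (v mod r))) = g (v mod r)"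
      using p[of "g (v mod r)"] g[OF vr] by auto
    have "c v = c (p (g (v mod r)))" using same[OF v(1) pU(1)] g[OF vr] by metis
    then have "g l = g (v mod r)" using v(2) pU(2) by metis
    then show ?thesis using g[OF that(1)] g[OF vr] by metis
  qed
  let ?S = "{v \<in> U. c v = g 0} - Z" and ?T = "{v \<in> U. c v = g 1} - Z"
  have S: "?S \<subseteq> A"
  proof
    fix v assume "v \<in> ?S"
    then show "v \<in> A" using class_colour[of 0 v] out[of v] r by (simp add: A_def)
  qed
  have T: "?T \<subseteq> B"
  proof
    fix v assume "v \<in> ?T"
    then show "v \<in> B" using class_colour[of 1 v] out[of v] r by (simp add: B_def)
  qed
  obtain i a b where ab: "i < d" "a \<in> ?S" "b \<in> ?T" "f i a = f i b"
    using sep[OF S T bigW bigW] g[of 0] g[of 1] r by fastforce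
  then have "{a, b} \<notin> edges H"
    using S T by (intro colliding_pair_blocked[OF H, of a b i]) (auto simp: A_def B_def)
  moreover have "g 0 \<noteq> g 1" using g[of 0] g[of 1] r by auto
  ultimately show False using U(2)[of a b] ab by auto
qed

end

section \<open>Saturated graphs without balanced multipartite subgraphs\<close>

text \<open>Edges inside the classes are unrestricted, so the notion covers subgraph copies of Turan
  graphs as well as the induced Turan graphs behind \<open>turan_dist\<close>.\<close>

definition small_classes :: "nat \<Rightarrow> 'v ugraph \<Rightarrow> real \<Rightarrow> bool" where
  "small_classes r H q \<longleftrightarrow>
     (\<forall>U c. U \<subseteq> verts H \<and> (\<forall>u\<in>U. \<forall>v\<in>U. c u \<noteq> c v \<longrightarrow> {u, v} \<in> edges H) \<longrightarrow>
        (\<exists>i<r. real (card {v \<in> U. c v = i}) < q))"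

lemma small_classes_mono: "small_classes r H p \<Longrightarrow> p \<le> q \<Longrightarrow> small_classes r H q"
  unfolding small_classes_def by (meson order_less_le_trans)

text \<open>Feeds the random labellings into the construction. \<open>large\<close> is what the
  union bound requires for \<open>A\<close> and \<open>B\<close> of size at most
  \<open>n0 div r + 1\<close>; the premise on \<open>q\<close> makes it a bound for the collisions
  of one labelling, which are at most twice their mean.\<close>

lemma exists_saturated_without_balanced_multipartite:
  fixes r d m k n0 L q :: nat
  assumes r: "r \<ge> 2" and m: "m > 0" and d: "d > 0" and k: "k > 0"
    and room: "d * m * r + r \<le> n0" and n: "n = n0 + d * m"
    and L: "L = m ^ (r - 1)" and large: "2 * (n0 div r + 1) + (L + 1) * d < 2 * k * d"
    and q: "\<And>x. L * x \<le> 2 * (n0 div r + 1)\<^sup>2 \<Longrightarrow> x \<le> q"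
  obtains H where "verts H = {..<n}" "saturated (r + 1) H"
    "turan_number r n \<le> card (edges H) + d * q
      + d * m * r * (d * m * r + 2 * (n0 div r + 1)) + d * m * n"
    "small_classes r H (real (k + (d * m * r + d * m + 2)))"
proof -
  define P where "P = {v. v < n0 \<and> v mod r = 0 \<and> 2 \<le> v}"
  define Q where "Q = {v. v < n0 \<and> v mod r = 1 \<and> 2 \<le> v}"
  have fin: "finite P" "finite Q" and disj: "P \<inter> Q = {}" by (auto simp: P_def Q_def)
  have "card P \<le> card {v \<in> {..<n0}. v mod r = 0}" "card Q \<le> card {v \<in> {..<n0}. v mod r = 1}"
    by (rule card_mono; force simp: P_def Q_def)+
  then have cA: "card P \<le> n0 div r + 1" and cB: "card Q \<le> n0 div r + 1"
    using card_residue_class[of 0 r n0] card_residue_class[of 1 r n0] r by (auto split: if_splits)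
  have L0: "L > 0" using L m by simp
  have "card P + card Q + (L + 1) * d < 2 * k * d" 
    using add_mono[OF cA cB] large by (simp add: algebra_simps)
  from exists_separating_labellings[OF fin disj L0 this]
  obtain f where f: "\<forall>i<d. \<forall>v\<in>P \<union> Q. f i v < L"
    "\<forall>i<d. L * card {(a, b) \<in> P \<times> Q. f i a = f i b} \<le> 2 * (card P * card Q)"
    "\<forall>S T. S \<subseteq> P \<and> T \<subseteq> Q \<and> k \<le> card S \<and> k \<le> card T \<longrightarrow> (\<exists>i<d. \<exists>a\<in>S. \<exists>b\<in>T. f i a = f i b)" .
  \<comment> \<open>The positions 2 to \<open>r\<close> give r - 1 digits, so labels and digit
    vectors are equinumerous; any bijection \<open>g\<close> can serve as the expansion in base
    \<open>m\<close>.\<close>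
  have cardD: "card ({2..r} \<rightarrow>\<^sub>E {..<m}) = L" using L r by (simp add: card_PiE)
  then have "\<exists>g. bij_betw g {..<L} ({2..r} \<rightarrow>\<^sub>E {..<m})"
    by (intro finite_same_card_bij) (simp_all add: finite_PiE)
  then obtain g where g: "bij_betw g {..<L} ({2..r} \<rightarrow>\<^sub>E {..<m})" by blast
  define h where "h x l = (if l \<in> {2..r} then g x l else 0)" for x l
  \<comment> \<open>The dummy labels are put in at 0 and 1, which lie outside \<open>P\<close> and
    \<open>Q\<close>.\<close>
  define f' where "f' i v = (if v = 0 then L else if v = 1 then L + 1 else f i v)" for i v :: nat
  have gE: "g x \<in> {2..r} \<rightarrow>\<^sub>E {..<m}" if "x < L" for x
    using g that by (auto simp: bij_betw_def)
  interpret blocked_turan r d m n0 L f' h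
  proof
    show "f' i v < L" if "i < d" "v < n0" "2 \<le> v" "v mod r < 2" for i v
    proof -
      have "v \<in> P \<union> Q" using that by (auto simp: P_def Q_def less_2_cases_iff)
      then show ?thesis using f(1) that by (auto simp: f'_def)
    qed
    show "h x l < m" if "x < L" for x l
      using PiE_mem[OF gE[OF that], of l] m by (auto simp: h_def)
    show "x = y" if "x < L" "y < L" "\<forall>l\<in>{2..r}. h x l = h y l" for x y
    proof -
      have "g x = g y"
        using that(3) by (intro PiE_ext[OF gE[OF that(1)] gE[OF that(2)]]) (simp add: h_def)
      then show ?thesis using g that(1,2) by (auto simp: bij_betw_def inj_on_def)
    qed
  qed (use r m d room in \<open>simp_all add: f'_def\<close>)
  have nn: "blocked_turan.n d m n0 = n" using n n_def by simp
  have classes: "blocked_turan.A r n0 = P" "blocked_turan.B r n0 = Q"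
    by (simp_all add: P_def Q_def blocked_turan.A_def[OF blocked_turan_axioms] blocked_turan.B_def[OF blocked_turan_axioms])
  have f'f: "f' i a = f i a" if "a \<in> P \<union> Q" for i a
    using that by (auto simp: f'_def P_def Q_def)
  obtain H where H: "verts H = verts G" "edges G \<subseteq> edges H" "saturated (r + 1) H"
    using saturated_extension[OF simple_G K_free] .
  have "card {(a, b) \<in> P \<times> Q. f' i a = f' i b} \<le> q" if "i < d" for i
  proof (rule q)
    have "{(a, b) \<in> P \<times> Q. f' i a = f' i b} = {(a, b) \<in> P \<times> Q. f i a = f i b}"
      using f'f by auto
    then have "L * card {(a, b) \<in> P \<times> Q. f' i a = f' i b} \<le> 2 * (card P * card Q)"
      using f(2) that by simp
    also have "\<dots> \<le> 2 * ((n0 div r + 1) * (n0 div r + 1))"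
      using cA cB by (intro mult_le_mono) auto
    finally show "L * card {(a, b) \<in> P \<times> Q. f' i a = f' i b} \<le> 2 * (n0 div r + 1)\<^sup>2"
      by (simp add: power2_eq_square)
  qed
  from turan_number_le_card_edges[unfolded classes nn, OF this]
  have "turan_number r n \<le> card (edges G) + d * q
      + d * m * r * (d * m * r + 2 * (n0 div r + 1)) + d * m * n" .
  moreover have "card (edges G) \<le> card (edges H)"
  proof (rule card_mono[OF _ H(2)])
    show "finite (edges H)"
      using H(3) by (intro finite_subset[of "edges H" "Pow (verts H)"])
        (auto simp: saturated_def simple_graph_def)
  qed
  ultimately have *: "turan_number r n \<le> card (edges H) + d * q
      + d * m * r * (d * m * r + 2 * (n0 div r + 1)) + d * m * n" by linarith
  have VH: "verts H = {..<n}" using H(1) nn by simp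
  have sep: "\<exists>i<d. \<exists>a\<in>S. \<exists>b\<in>T. f' i a = f' i b"
    if ST: "S \<subseteq> P" "T \<subseteq> Q" "k \<le> card S" "k \<le> card T" for S T
  proof -
    obtain i a b where "i < d" "a \<in> S" "b \<in> T" "f i a = f i b" using f(3) ST by blast
    moreover from this have "f' i a = f i a" "f' i b = f i b" using f'f ST by auto
    ultimately show ?thesis by metis
  qed
  show thesis
  proof (rule that[OF VH H(3) *])
    show "small_classes r H (real (k + (d * m * r + d * m + 2)))"
      unfolding small_classes_def of_nat_less_iff
    proof (intro allI impI)
      fix U and c :: "nat \<Rightarrow> nat"
      assume U: "U \<subseteq> verts H \<and> (\<forall>u\<in>U. \<forall>v\<in>U. c u \<noteq> c v \<longrightarrow> {u, v} \<in> edges H)"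
      show "\<exists>i<r. card {v \<in> U. c v = i} < k + (d * m * r + d * m + 2)"
        using small_class[unfolded classes nn, OF VH H(2,3) sep _ _ k, of U c] U VH by simp
    qed
  qed
qed

section \<open>Choice of the parameters\<close>

text \<open>With \<open>m\<close> about n^(1/r), the number \<open>L\<close> of labels has order
  n^(1 - 1/r) for fixed \<open>r\<close>, which is negligible against n/r. The union bound then
  holds with \<open>k\<close> about 3n/(dr), and the exceptional vertices, of order d r m, fit into
  another n/(dr).\<close>

lemma eventually_saturated_without_balanced_multipartite:
  fixes r d :: nat
  assumes r: "r \<ge> 2" and d: "d > 0"
  shows "\<forall>\<^sub>F n in sequentially. \<exists>H :: nat ugraph. verts H = {..<n} \<and> saturated (r + 1) H \<and>
    real (card (edges H)) \<ge> real (turan_number r n) - 13 * real d * real n powr (real (r + 1) / real r) \<and>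
    small_classes r H (4 * real n / (real d * real r))"
proof -
  define D R where "D = real d" and "R = real r"
  have D: "D \<ge> 1" and R: "R \<ge> 2" using r d by (auto simp: D_def R_def)
  \<comment> \<open>The summands are the thresholds for \<open>y2\<close>, \<open>small3\<close>,
    \<open>slack\<close>, \<open>small1\<close> and \<open>small2\<close>, in this order.\<close>
  define K where "K = 2 + R * (2 + 3 * D + D * 2 ^ r) + D * R * (2 * D * R + 2 * D + 2)
    + (2 * D * R + 2 * D + R) + 4 * D * R\<^sup>2"
  have pos: "0 \<le> R * (2 + 3 * D + D * 2 ^ r)" "0 \<le> D * R * (2 * D * R + 2 * D + 2)"
    "0 \<le> 2 * D * R + 2 * D + R" "0 \<le> 4 * D * R\<^sup>2"
    using D R by auto
  have "\<forall>\<^sub>F n in sequentially. K \<le> real n powr (1 / R)"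
    using eventually_ge_at_top[of "nat \<lceil>K powr R\<rceil>"]
  proof eventually_elim
    case (elim n)
    have "(K powr R) powr (1 / R) \<le> real n powr (1 / R)"
      using elim R by (intro powr_mono2) auto
    moreover have "K \<ge> 0" using pos by (simp add: K_def)
    ultimately show ?case using R by (simp add: powr_powr)
  qed
  then show ?thesis
    using eventually_gt_at_top[of 0]
  proof eventually_elim
    case (elim n)
    define y w N where "y = real n powr (1 / R)" and "w = y ^ (r - 1)" and "N = real n"
    have yK: "K \<le> y" using elim by (simp add: y_def)
    have y2: "y \<ge> 2" using yK pos by (simp add: K_def)
    have yr: "y ^ r = N"
    proof -
      have "y ^ r = y powr R" using y2 by (simp add: powr_realpow R_def)
      also have "\<dots> = N" using elim R by (simp add: y_def powr_powr N_def)
      finally show ?thesis .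
    qed
    have Nyw: "N = y * w" using yr r unfolding w_def by (metis power_eq_if not_numeral_le_zero)
    have wy: "y \<le> w"
      using y2 r power_increasing[of 1 "r - 1" y] by (simp add: w_def)
    have w1: "w \<ge> 2" using wy y2 by simp
    have Ny: "N powr (real (r + 1) / real r) = N * y"
    proof -
      have "real (r + 1) / real r = 1 + 1 / R" using R by (simp add: R_def field_simps)
      then show ?thesis using elim by (simp add: powr_add y_def N_def)
    qed
    define m where "m = nat \<lceil>y\<rceil>"
    have my: "y \<le> real m" unfolding m_def by (rule real_nat_ceiling_ge)
    have m2y: "real m \<le> 2 * y" using y2 unfolding m_def by linarith
    have m0: "m > 0" using my y2 by (cases m) auto
    define L where "L = m ^ (r - 1)"
    have Lw: "w \<le> real L" using my y2 by (auto simp: L_def w_def intro: power_mono)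
    have L2w: "real L \<le> 2 ^ r * w"
    proof -
      have "real L \<le> (2 * y) ^ (r - 1)" using power_mono[OF m2y, of "r - 1"] by (simp add: L_def)
      also have "\<dots> = 2 ^ (r - 1) * w" by (simp add: w_def power_mult_distrib)
      also have "\<dots> \<le> 2 ^ r * w" using w1 by (intro mult_right_mono power_increasing) auto
      finally show ?thesis .
    qed
    \<comment> \<open>The union bound asks for slightly more than n/(dr); the factor 3 leaves room
      for lower order terms and rounding.\<close>
    define k where "k = nat \<lfloor>3 * N / (D * R)\<rfloor>"
    have DR: "D * R > 0" using D R by simp
    have Kw: "D * R * (2 * D * R + 2 * D + 2) \<le> w" "2 * D * R + 2 * D + R \<le> w" "4 * D * R\<^sup>2 \<le> w"
      using yK wy pos unfolding K_def by linarith+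
    have yw: "c * y \<le> N" if "c \<le> w" for c
      using mult_right_mono[OF that, of y] y2 by (simp add: Nyw mult.commute)
    have slack: "(2 * D * R + 2 * D + 2) * y \<le> N / (D * R)"
      using yw[OF Kw(1)] DR by (simp add: pos_le_divide_eq mult_ac)
    have small1: "(2 * D * R + 2 * D + R) * y \<le> N" and small2: "(4 * D * R\<^sup>2) * y \<le> N"
      using yw Kw(2,3) by blast+
    have small3: "(2 + 3 * D + D * 2 ^ r) * w < N / R"
    proof -
      have "R * (2 + 3 * D + D * 2 ^ r) < y" using yK pos unfolding K_def by linarith
      then have "R * (2 + 3 * D + D * 2 ^ r) * w < y * w" using w1 by (intro mult_strict_right_mono) auto
      then show ?thesis using R by (simp add: Nyw pos_less_divide_eq mult_ac)
    qed
    have kle: "real k \<le> 3 * N / (D * R)"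
      using DR unfolding k_def by (simp add: N_def)
    have kge: "3 * N / (D * R) - 1 \<le> real k" unfolding k_def by linarith
    have k0: "k > 0"
    proof -
      have "1 * 2 \<le> (2 * D * R + 2 * D + 2) * y" using D R y2 by (intro mult_mono) auto
      then have "real k > 0" using kge slack by simp
      then show ?thesis by simp
    qed
    have DmR: "real (d * m * r) \<le> 2 * D * R * y" and Dm: "real (d * m) \<le> 2 * D * y"
    proof -
      show "real (d * m) \<le> 2 * D * y"
        using mult_left_mono[OF m2y, of D] D by (simp add: D_def mult_ac)
      then show "real (d * m * r) \<le> 2 * D * R * y"
        using mult_right_mono[of "real (d * m)" "2 * D * y" R] R by (simp add: R_def mult_ac)
    qed
    have Ry: "R \<le> R * y" using R y2 by simp
    have "real (d * m * r + r + d * m) \<le> real n"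
      using DmR Dm Ry small1 by (simp add: algebra_simps R_def N_def)
    then have le: "d * m * r + r + d * m \<le> n" by (simp only: of_nat_le_iff)
    define n0 where "n0 = n - d * m"
    have n: "n = n0 + d * m" and room: "d * m * r + r \<le> n0" using le by (auto simp: n0_def)
    have n0r: "real (n0 div r) \<le> N / R"
    proof -
      have "real (n0 div r) \<le> real n0 / R"
        unfolding R_def by (rule of_nat_div_le_of_nat)
      also have "\<dots> \<le> N / R" using R n by (intro divide_right_mono) (auto simp: N_def)
      finally show ?thesis .
    qed
    have large: "2 * (n0 div r + 1) + (L + 1) * d < 2 * k * d"
    proof -
      have LD: "real L * D \<le> D * (2 ^ r * w)"
        using mult_left_mono[OF L2w, of D] D by (simp add: mult.commute)
      have "real (2 * (n0 div r + 1) + (L + 1) * d) = 2 * real (n0 div r) + 2 + D + real L * D"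
        by (simp add: D_def algebra_simps)
      also have "\<dots> \<le> 2 * (N / R) + 2 + D + D * (2 ^ r * w)"
        using n0r LD by linarith
      \<comment> \<open>The term \<open>2 * D\<close> is split off to absorb the rounding in
        \<open>k\<close>.\<close>
      also have "\<dots> \<le> 2 * (N / R) + (2 + 3 * D + D * 2 ^ r) * w - 2 * D"
      proof -
        have "(2 + 3 * D + D * 2 ^ r) * w = (2 + 3 * D) * w + D * (2 ^ r * w)"
          by (simp add: algebra_simps)
        moreover have "2 + 3 * D \<le> (2 + 3 * D) * w"
          using mult_left_mono[of 1 w "2 + 3 * D"] w1 D by simp
        ultimately show ?thesis by linarith
      qed
      also have "\<dots> < 3 * (N / R) - 2 * D" using small3 by simp
      also have "\<dots> \<le> 6 * (N / R) - 2 * D"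
      proof -
        have "0 \<le> N / R" using R by (simp add: N_def)
        then show ?thesis by linarith
      qed
      also have "\<dots> = 2 * D * (3 * N / (D * R) - 1)" using D R by (simp add: field_simps)
      also have "\<dots> \<le> 2 * D * real k" using kge D by (intro mult_left_mono) auto
      also have "\<dots> = real (2 * k * d)" by (simp add: D_def)
      finally show ?thesis by (simp only: of_nat_less_iff)
    qed
    define q where "q = 2 * (n0 div r + 1)\<^sup>2 div L"
    have L0: "L > 0" using m0 by (simp add: L_def)
    have q: "x \<le> q" if "L * x \<le> 2 * (n0 div r + 1)\<^sup>2" for x
      using div_le_mono[OF that, of L] L0 by (simp add: q_def)
    obtain H where H: "verts H = {..<n}" "saturated (r + 1) H"
      "turan_number r n \<le> card (edges H) + d * q
        + d * m * r * (d * m * r + 2 * (n0 div r + 1)) + d * m * n"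
      "small_classes r H (real (k + (d * m * r + d * m + 2)))"
      using exists_saturated_without_balanced_multipartite[OF r m0 d k0 room n L_def large q] .
    have N4: "N \<ge> 4" using mult_mono[of 2 y 2 w] y2 w1 by (simp add: Nyw)
    have RN: "R \<le> N" using le by (simp add: R_def N_def)
    have half: "N / R + 1 \<le> N"
    proof -
      have "N / R \<le> N / 2" using R N4 by (intro divide_left_mono) auto
      then show ?thesis using N4 by linarith
    qed
    have loss1: "real (d * q) \<le> 2 * D * (N * y)"
    proof -
      have "real q \<le> real (2 * (n0 div r + 1)\<^sup>2) / real L" unfolding q_def by (rule of_nat_div_le_of_nat)
      also have "\<dots> \<le> 2 * N\<^sup>2 / w"
        using n0r half Lw w1 by (intro frac_le) (auto intro!: power_mono)
      also have "\<dots> = 2 * (N * y)" using w1 by (simp add: Nyw power2_eq_square)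
      finally show ?thesis using D mult_left_mono[of "real q" "2 * (N * y)" D] by (simp add: D_def mult_ac)
    qed
    have loss2: "real (d * m * r) * real (d * m * r) \<le> D * (N * y)"
    proof -
      have "real (d * m * r) * real (d * m * r) \<le> (2 * D * R * y) * (2 * D * R * y)"
        using DmR D R y2 by (intro mult_mono) auto
      also have "\<dots> = D * (((4 * D * R\<^sup>2) * y) * y)" by (simp add: power2_eq_square)
      also have "\<dots> \<le> D * (N * y)"
        using small2 D y2 by (intro mult_left_mono mult_right_mono) auto
      finally show ?thesis .
    qed
    \<comment> \<open>The factor \<open>R\<close> from the blockers of all colours cancels against
      the class size \<open>N / R\<close>, so the bound is free of \<open>r\<close>.\<close>
    have loss3: "real (d * m * r) * (2 * (real (n0 div r) + 1)) \<le> 8 * D * (N * y)"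
    proof -
      have "real (d * m * r) * (2 * (real (n0 div r) + 1)) \<le> (2 * D * R * y) * (2 * (N / R + 1))"
        using DmR n0r D R y2 by (intro mult_mono) auto
      also have "\<dots> = 4 * D * y * (N + R)" using R by (simp add: field_simps)
      also have "\<dots> \<le> 4 * D * y * (2 * N)" using RN D y2 by (intro mult_left_mono) auto
      finally show ?thesis by (simp add: mult_ac)
    qed
    have loss4: "real (d * m * n) \<le> 2 * D * (N * y)"
      using mult_right_mono[OF Dm, of N] by (simp add: N_def mult_ac)
    have "real (turan_number r n) \<le> real (card (edges H) + d * q
        + d * m * r * (d * m * r + 2 * (n0 div r + 1)) + d * m * n)"
      using H(3) by (simp only: of_nat_le_iff)
    also have "\<dots> = real (card (edges H)) + real (d * q) + (real (d * m * r) * real (d * m * r)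
        + real (d * m * r) * (2 * (real (n0 div r) + 1))) + real (d * m * n)"
      by (simp add: distrib_left)
    \<comment> \<open>The constant is 2 + 1 + 8 + 2 from the four losses.\<close>
    also have "\<dots> \<le> real (card (edges H)) + 13 * D * (N * y)"
      using loss1 loss2 loss3 loss4 by simp
    finally have E: "real (card (edges H)) \<ge> real (turan_number r n) - 13 * real d * real n powr (real (r + 1) / real r)"
      using Ny by (simp add: D_def N_def)
    have "real (k + (d * m * r + d * m + 2)) \<le> 3 * N / (D * R) + (2 * D * R + 2 * D + 2) * y"
      using kle DmR Dm y2 by (simp add: algebra_simps)
    also have "\<dots> \<le> 4 * N / (D * R)" using slack by simp
    finally have "small_classes r H (4 * real n / (real d * real r))"
      using small_classes_mono[OF H(4)] by (simp add: D_def R_def N_def)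
    then show ?case using H(1,2) E by blast
  qed
qed

section \<open>From small classes to Turan subgraphs and \<open>turan_dist\<close>\<close>

text \<open>The residues modulo \<open>r\<close>, carried over by the embedding, split the copy into
  classes of at least \<open>k div r\<close> vertices each.\<close>

lemma no_copy_of_turan_graph:
  fixes H :: "'v ugraph" and q :: real
  assumes small: "small_classes r H q"
    and k: "q \<le> real (k div r)"
  shows "\<not> contains_copy H (turan_graph r k)"
proof
  assume "contains_copy H (turan_graph r k)"
  then obtain g where g: "inj_on g {..<k}" "g ` {..<k} \<subseteq> verts H"
    "\<forall>e\<in>edges (turan_graph r k). g ` e \<in> edges H"
    unfolding contains_copy_def turan_graph_def by auto
  define c where "c v = inv_into {..<k} g v mod r" for v
  have c: "c (g j) = j mod r" if "j < k" for j
    using that g(1) by (simp add: c_def)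
  have "\<forall>u\<in>g ` {..<k}. \<forall>v\<in>g ` {..<k}. c u \<noteq> c v \<longrightarrow> {u, v} \<in> edges H"
  proof (intro ballI impI)
    fix u v assume "u \<in> g ` {..<k}" "v \<in> g ` {..<k}" "c u \<noteq> c v"
    then obtain i j where ij: "u = g i" "v = g j" "i < k" "j < k" "i mod r \<noteq> j mod r"
      using c by auto
    then have "{i, j} \<in> edges (turan_graph r k)" by (auto simp: turan_graph_def)
    then have "g ` {i, j} \<in> edges H" using g(3) by blast
    then show "{u, v} \<in> edges H" using ij by simp
  qed
  then obtain i where i: "i < r" "real (card {v \<in> g ` {..<k}. c v = i}) < q"
    using small g(2) unfolding small_classes_def by blast
  have "{v \<in> g ` {..<k}. c v = i} = g ` {j \<in> {..<k}. j mod r = i}" using c by auto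
  moreover have "card (g ` {j \<in> {..<k}. j mod r = i}) = card {j \<in> {..<k}. j mod r = i}"
    using g(1) by (intro card_image) (auto simp: inj_on_def)
  ultimately have "k div r \<le> card {v \<in> g ` {..<k}. c v = i}"
    using card_residue_class[OF i(1), of k] by simp
  then show False using i(2) k by linarith
qed

text \<open>An optimal \<open>T\<close> leaves a Turan graph on a set \<open>U\<close>, whose
  classes all have at least |U|/r - 1 vertices. One of them has fewer than \<open>q\<close>, so |U|
  is at most r(q + 1).\<close>

lemma turan_dist_ge:
  fixes H :: "'v ugraph" and q :: real
  assumes H: "simple_graph H" and r: "r > 0"
    and small: "small_classes r H q"
  shows "real (turan_dist r H) \<ge> real (card (verts H)) - real r * (q + 1)"
proof -
  let ?S = "{card T | T. T \<subseteq> verts H \<and> is_turan r (delete_verts H T)}"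
  have "turan_dist r H \<in> ?S"
    unfolding turan_dist_def using turan_dist_set[OF H, of r] by (rule Min_in)
  then obtain T where T: "turan_dist r H = card T" "T \<subseteq> verts H" "is_turan r (delete_verts H T)"
    by blast
  define U where "U = verts H - T"
  obtain c where c: "\<forall>i<r. int (card {v \<in> U. c v = i}) \<in> {\<lfloor>real (card U) / real r\<rfloor>, \<lceil>real (card U) / real r\<rceil>}"
    "edges (delete_verts H T) = {{u, v} | u v. u \<in> U \<and> v \<in> U \<and> c u \<noteq> c v}"
    using T(3) unfolding is_turan_def by (auto simp: delete_verts_def U_def)
  have "\<forall>u\<in>U. \<forall>v\<in>U. c u \<noteq> c v \<longrightarrow> {u, v} \<in> edges H"
  proof (intro ballI impI)
    fix u v assume "u \<in> U" "v \<in> U" "c u \<noteq> c v"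
    then have "{u, v} \<in> edges (delete_verts H T)" unfolding c(2) by blast
    then show "{u, v} \<in> edges H" by (simp add: delete_verts_def)
  qed
  then obtain i where i: "i < r" "real (card {v \<in> U. c v = i}) < q"
    using small[unfolded small_classes_def, rule_format, of U c] by (auto simp: U_def)
  have "\<lfloor>real (card U) / real r\<rfloor> \<le> int (card {v \<in> U. c v = i})"
    using c(1) i(1) floor_le_ceiling[of "real (card U) / real r"] by fastforce
  then have "real (card U) / real r - 1 \<le> real (card {v \<in> U. c v = i})" by linarith
  then have "real (card U) / real r \<le> q + 1" using i(2) by linarith
  then have "real (card U) \<le> real r * (q + 1)"
    using r by (simp add: pos_divide_le_eq mult.commute)
  moreover have "card U = card (verts H) - card T" "card T \<le> card (verts H)"
    using T(2) H by (auto simp: U_def simple_graph_def card_Diff_subset finite_subset card_mono)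
  ultimately show ?thesis using T(1) by simp
qed

lemma exists_saturated_without_turan_graph:
  fixes r :: nat and \<delta> :: real
  assumes r: "r \<ge> 2" and \<delta>: "\<delta> > 0"
  shows "\<exists>C::real. \<forall>\<^sub>F n::nat in sequentially. \<exists>G::nat ugraph. verts G = {..<n} \<and> saturated (r + 1) G \<and>
    \<not> contains_copy G (turan_graph r (nat \<lfloor>\<delta> * real r * real n\<rfloor>)) \<and>
    real (card (edges G)) \<ge> real (turan_number r n) - C * real n powr (real (r + 1) / real r)"
proof -
  \<comment> \<open>With \<open>d\<close> at least 8/\<delta> the class bound 4n/(dr) is at most
    half of \<delta>n.\<close>
  define d where "d = nat \<lceil>8 / \<delta>\<rceil> + 1"
  have d0: "d > 0" by (simp add: d_def)
  have "8 / \<delta> \<le> real d" unfolding d_def by linarith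
  then have d: "8 \<le> real d * \<delta>" using \<delta> by (simp add: pos_divide_le_eq)
  have "\<forall>\<^sub>F n in sequentially. \<exists>G :: nat ugraph. verts G = {..<n} \<and> saturated (r + 1) G \<and>
    \<not> contains_copy G (turan_graph r (nat \<lfloor>\<delta> * real r * real n\<rfloor>)) \<and>
    real (card (edges G)) \<ge> real (turan_number r n) - (13 * real d) * real n powr (real (r + 1) / real r)"
    using eventually_saturated_without_balanced_multipartite[OF r d0]
      eventually_ge_at_top[of "nat \<lceil>4 / \<delta>\<rceil>"]
  proof eventually_elim
    case (elim n)
    then obtain H :: "nat ugraph" where H: "verts H = {..<n}" "saturated (r + 1) H"
      "real (card (edges H)) \<ge> real (turan_number r n) - 13 * real d * real n powr (real (r + 1) / real r)"
      "small_classes r H (4 * real n / (real d * real r))"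
      by blast
    define k where "k = nat \<lfloor>\<delta> * real r * real n\<rfloor>"
    have "4 / \<delta> \<le> real n" using elim(2) by linarith
    \<comment> \<open>The classes of the Turan graph have at least \<delta>n - 1 vertices, which is
      now more than half of \<delta>n.\<close>
    then have n: "4 \<le> \<delta> * real n" using \<delta> by (simp add: pos_divide_le_eq mult.commute)
    have "k mod r < r" "k div r * r + k mod r = k" using r by simp_all
    then have "k + 1 \<le> (k div r + 1) * r" unfolding add_mult_distrib by linarith
    then have "real (k + 1) \<le> real ((k div r + 1) * r)" by (simp only: of_nat_le_iff)
    then have "real k + 1 \<le> (real (k div r) + 1) * real r" by (simp add: algebra_simps)
    moreover have "\<delta> * real r * real n \<le> real k + 1"
      unfolding k_def by linarith
    ultimately have "(\<delta> * real n) * real r \<le> (real (k div r) + 1) * real r" by (simp add: mult_ac)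
    then have 1: "\<delta> * real n \<le> real (k div r) + 1" using r by simp
    have "4 * real n / (real d * real r) \<le> \<delta> * real n / 2"
    proof -
      have "8 * real n \<le> (real d * \<delta>) * real n" using d by (intro mult_right_mono) auto
      also have "\<dots> \<le> (real d * \<delta>) * real n * real r"
        using r \<delta> mult_left_mono[of 1 "real r" "real d * \<delta> * real n"] by simp
      finally show ?thesis using d0 r by (simp add: field_simps)
    qed
    then have "4 * real n / (real d * real r) \<le> real (k div r)" using 1 n by linarith
    then have "\<not> contains_copy H (turan_graph r k)"
      using H(4) by (intro no_copy_of_turan_graph)
    then show ?case using H(1-3) unfolding k_def by blast
  qed
  then show ?thesis by blast
qed

text \<open>The bound obtained is n - 130n/D with 130 = 5 * 26; as \<open>ln (D * real r)\<close> is
  at least 1, the logarithmic form follows.\<close>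

lemma max_turan_dist_ge:
  fixes r :: nat and D :: real
  assumes r: "r \<ge> 2" and D: "D \<ge> 26"
  shows "\<forall>\<^sub>F n::nat in sequentially.
    real (max_turan_dist r n (D * real n powr (real (r + 1) / real r))) \<ge> (1 - 130 * ln (D * real r) / D) * real n"
proof -
  \<comment> \<open>13 is the constant of the edge loss; \<open>D \<ge> 26\<close> ensures that
    rounding down still leaves \<open>d\<close> at least D/26.\<close>
  define d where "d = nat \<lfloor>D / 13\<rfloor>"
  have d: "D / 26 \<le> real d" "13 * real d \<le> D"
  proof -
    have "real d \<le> D / 13" "D / 13 - 1 \<le> real d" unfolding d_def using D by linarith+
    then show "D / 26 \<le> real d" "13 * real d \<le> D" using D by simp_all
  qed
  then have d0: "d > 0" using D by (cases d) auto
  have ln1: "1 \<le> ln (D * real r)"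
  proof -
    have "exp 1 \<le> (3::real)" by (rule exp_le)
    also have "3 \<le> D * real r" using mult_mono[of 26 D 2 "real r"] D r by simp
    finally show ?thesis using D r by (subst ln_ge_iff) auto
  qed
  show ?thesis
    using eventually_saturated_without_balanced_multipartite[OF r d0] eventually_ge_at_top[of "d * r"]
  proof eventually_elim
    case (elim n)
    then obtain H :: "nat ugraph" where H: "verts H = {..<n}" "saturated (r + 1) H"
      "real (card (edges H)) \<ge> real (turan_number r n) - 13 * real d * real n powr (real (r + 1) / real r)"
      "small_classes r H (4 * real n / (real d * real r))"
      by blast
    let ?m = "D * real n powr (real (r + 1) / real r)"
    have "13 * real d * real n powr (real (r + 1) / real r) \<le> ?m"
      using d(2) by (intro mult_right_mono) auto
    then have mem: "H \<in> saturated_graphs r n ?m"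
      using H(1-3) by (simp add: saturated_graphs_def)
    have "turan_dist r H \<le> max_turan_dist r n ?m"
      unfolding max_turan_dist_def using mem finite_saturated_graphs by (intro Max_ge) auto
    moreover have "real (turan_dist r H) \<ge> real (card (verts H)) - real r * (4 * real n / (real d * real r) + 1)"
      using H r by (intro turan_dist_ge) (auto simp: saturated_def)
    \<comment> \<open>Four of the five terms n/d come from the class bound; the fifth pays for the
      rounding term \<open>r\<close>, which is at most n/d once \<open>n\<close> is at least
      \<open>d * r\<close>.\<close>
    moreover have "real r * (4 * real n / (real d * real r) + 1) \<le> 5 * real n / real d"
    proof -
      have "real r * (4 * real n / (real d * real r) + 1) = 4 * real n / real d + real r"
        using r by (simp add: field_simps)
      moreover have "real d * real r \<le> real n" using elim(2) by (simp flip: of_nat_mult)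
      then have "real r \<le> real n / real d" using d0 by (simp add: pos_le_divide_eq mult.commute)
      ultimately show ?thesis by simp
    qed
    moreover have "5 * real n / real d \<le> 130 * ln (D * real r) / D * real n"
    proof -
      have "5 * real n / real d \<le> 5 * real n / (D / 26)"
        using d(1) D by (intro divide_left_mono) auto
      also have "\<dots> = 130 * 1 / D * real n" by simp
      also have "\<dots> \<le> 130 * ln (D * real r) / D * real n"
        using ln1 D by (intro mult_right_mono divide_right_mono mult_left_mono) auto
      finally show ?thesis .
    qed
    ultimately show ?case using H(1) by (simp add: left_diff_distrib)
  qed
qed

theorem theorem3:
  "(\<forall>r::nat. \<forall>\<delta>::real. r \<ge> 2 \<and> \<delta> > 0 \<longrightarrow>
      (\<exists>C::real. \<forall>\<^sub>F n::nat in sequentially.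
         \<exists>G::nat ugraph. verts G = {..<n} \<and> saturated (r + 1) G \<and>
           \<not> contains_copy G (turan_graph r (nat \<lfloor>\<delta> * real r * real n\<rfloor>)) \<and>
           real (card (edges G)) \<ge> real (turan_number r n) - C * real n powr (real (r + 1) / real r)))
   \<and>
   (\<exists>c'::real. \<forall>\<^sub>F D::real in at_top. \<forall>r::nat. r \<ge> 2 \<longrightarrow>
      (\<forall>\<^sub>F n::nat in sequentially.
         real (max_turan_dist r n (D * real n powr (real (r + 1) / real r)))
           \<ge> (1 - c' * ln (D * real r) / D) * real n))"
proof (intro conjI allI impI)
  show "\<exists>C::real. \<forall>\<^sub>F n::nat in sequentially.
      \<exists>G::nat ugraph. verts G = {..<n} \<and> saturated (r + 1) G \<and>
        \<not> contains_copy G (turan_graph r (nat \<lfloor>\<delta> * real r * real n\<rfloor>)) \<and>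
        real (card (edges G)) \<ge> real (turan_number r n) - C * real n powr (real (r + 1) / real r)"
    if "r \<ge> 2 \<and> \<delta> > 0" for r :: nat and \<delta> :: real
    using that exists_saturated_without_turan_graph by blast
  show "\<exists>c'::real. \<forall>\<^sub>F D::real in at_top. \<forall>r::nat. r \<ge> 2 \<longrightarrow>
      (\<forall>\<^sub>F n::nat in sequentially.
         real (max_turan_dist r n (D * real n powr (real (r + 1) / real r)))
           \<ge> (1 - c' * ln (D * real r) / D) * real n)"
    by (intro exI[of _ 130] eventually_mono[OF eventually_ge_at_top[of "26::real"]] allI impI max_turan_dist_ge)
qed

end
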